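(* Let $d\ge2$, $\zeta=\exp(2\pi i/d)$, and let $k\subset\mathbb{C}$ be a number field stable under complex conjugation and containing the group $\boldsymbol\mu_d$ of $d$-th roots of unity. Let $V=W=k$ with the Hermitian pairing $\langle a,b\rangle=ab^*$, and let $G=\boldsymbol\mu_d$ act on $V$ by multiplication. (1) Whenever $\mathfrak F=(\mathfrak a_1,\dots,\mathfrak a_{d-1})$ is a family of ideals of $\mathbb{Z}_k$ such that $\mathfrak a_j$ divides $(1-\zeta^j)\mathbb{Z}_k$ for each $1\le j\le d-1$, the set $$\mathfrak R(\mathfrak F):=\{(\mathfrak a_j,\ (1-\zeta^j)^*\mathfrak a_j^{-*},\ \zeta^j)\mid1\le j\le d-1\}$$ is a complete reduced $\mathbb{Z}_k$-root system for $G$. (2) The family $(\mathfrak R(\mathfrak F))$, where $\mathfrak F=(\mathfrak a_1,\dots,\mathfrak a_{d-1})$ runs over the families as in (1) such that $\mathfrak a_1,\dots,\mathfrak a_{d-1}$ are relatively prime (i.e. $\sum_j\mathfrak a_j=\mathbb{Z}_k$), is a complete set of representatives for the genera of complete reduced $\mathbb{Z}_k$-root systems for $G$.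
   Context: $\lambda\mapsto\lambda^*$ is complex conjugation, $\mathbb{Z}_k$ is the ring of integers of $k$, and $\mathfrak a^{-*}=(\mathfrak a^{-1})^*$ for a nonzero fractional ideal $\mathfrak a$. For $g\in\mathrm{GL}(V)$, $g^\vee\in\mathrm{GL}(W)$ is the unique element with $\langle gv,g^\vee w\rangle=\langle v,w\rangle$. A reflection on $V$ is a finite order element $s$ with $\ker(s-1)$ a hyperplane (here: multiplication by a nontrivial root of unity). A $\mathbb{Z}_k$-root is a triple $\mathfrak r=(I,J,\xi)$ with $I\subset V$, $J\subset W$ rank one finitely generated $\mathbb{Z}_k$-submodules, $\xi\ne1$ a root of unity in $k$, and $\langle I,J\rangle=(1-\xi)\mathbb{Z}_k$ (the fractional ideal generated by all $\langle\alpha,\beta\rangle$, $\alpha\in I,\beta\in J$). Its reflection is $s_{\mathfrak r}(x)=x-\langle x,w\rangle v$ for $v\in kI,w\in kJ$ with $\langle v,w\rangle=1-\xi$. Put $g\cdot(I,J,\xi)=(g(I),g^\vee(J),\xi)$ for $g\in\mathrm{GL}(V)$ and $\mathfrak a\cdot(I,J,\xi)=(\mathfrak aI,\mathfrak a^{-*}J,\xi)$ for a fractional ideal $\mathfrak a$. A $\mathbb{Z}_k$-root system is a finite set $\mathfrak R$ of $\mathbb{Z}_k$-roots whose $I_{\mathfrak r}$ generate $V$, with $s_{\mathfrak r}\cdot\mathfrak R=\mathfrak R$ for $\mathfrak r\in\mathfrak R$ and $\langle I_{\mathfrak r_1},J_{\mathfrak r_2}\rangle\subseteq\mathbb{Z}_k$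 for $\mathfrak r_1,\mathfrak r_2\in\mathfrak R$. It is a root system for $G$ if the $s_{\mathfrak r}$ generate $G$; reduced if $\mathfrak r\mapsto s_{\mathfrak r}$ is injective; complete if every reflection of $G$ is some $s_{\mathfrak r}$. Two root systems are of the same genus if $\mathfrak R_2=\mathfrak a\cdot\mathfrak R_1=\{\mathfrak a\cdot\mathfrak r\mid\mathfrak r\in\mathfrak R_1\}$ for some fractional ideal $\mathfrak a$. *)

theory Defs
  imports
    "HOL-Algebra.Algebra"
    "HOL-Algebra.Algebraic_Closure_Type"
    "HOL-Library.Set_Algebras"
    Complex_Main
begin

section \<open>Number fields inside the complex numbers\<close>

text \<open>The complex field as a HOL-Algebra ring, so that subfields, ideals and dimensions of
  sets of complex numbers are the notions of HOL-Algebra.\<close>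

abbreviation complex_field :: "complex ring"
  where "complex_field \<equiv> ring_of_type_algebra"

definition number_field :: "complex set \<Rightarrow> bool"
  where "number_field k \<longleftrightarrow>
    subfield k complex_field \<and> ring.finite_dimension complex_field \<rat> k"

definition integers_of :: "complex set \<Rightarrow> complex set"
  where "integers_of k = {x \<in> k. algebraic_int x}"

definition integer_ring :: "complex set \<Rightarrow> complex ring"
  where "integer_ring k = complex_field\<lparr>carrier := integers_of k\<rparr>"

text \<open>Finite linear combinations of elements of \<open>S\<close> with coefficients in \<open>A\<close>. For \<open>A\<close> a ring of
  scalars this is the \<open>A\<close>-submodule generated by \<open>S\<close>; for \<open>A\<close> an ideal and \<open>S\<close> a module it is
  the module product \<open>AS\<close>.\<close>

definition lincomb :: "complex set \<Rightarrow> (complex \<Rightarrow> 'v \<Rightarrow> 'v) \<Rightarrow> 'v set \<Rightarrow> 'v::ab_group_add set"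
  where "lincomb A sc S =
    {\<Sum>x\<in>F. sc (c x) x | F c. finite F \<and> F \<subseteq> S \<and> (\<forall>x\<in>F. c x \<in> A)}"

definition fg_submodule ::
    "complex set \<Rightarrow> (complex \<Rightarrow> 'v \<Rightarrow> 'v) \<Rightarrow> 'v set \<Rightarrow> 'v::ab_group_add set \<Rightarrow> bool"
  where "fg_submodule A sc V M \<longleftrightarrow> (\<exists>S. finite S \<and> S \<subseteq> V \<and> M = lincomb A sc S)"

definition fractional_ideal :: "complex set \<Rightarrow> complex set \<Rightarrow> bool"
  where "fractional_ideal k \<aa> \<longleftrightarrow> fg_submodule (integers_of k) (*) k \<aa> \<and> \<aa> \<noteq> {0}"

definition frac_inverse :: "complex set \<Rightarrow> complex set \<Rightarrow> complex set"
  where "frac_inverse k \<aa> = {x \<in> k. \<forall>a\<in>\<aa>. x * a \<in> integers_of k}"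

definition frac_inverse_conj :: "complex set \<Rightarrow> complex set \<Rightarrow> complex set"
  where "frac_inverse_conj k \<aa> = cnj ` frac_inverse k \<aa>"

definition ideal_divides :: "complex set \<Rightarrow> complex set \<Rightarrow> complex set \<Rightarrow> bool"
  where "ideal_divides k \<aa> \<bb> \<longleftrightarrow>
    (\<exists>\<cc>. ideal \<cc> (integer_ring k) \<and> \<bb> = \<aa> \<cdot>\<^bsub>integer_ring k\<^esub> \<cc>)"

section \<open>Linear groups and reflections\<close>

text \<open>Vector spaces are sets of vectors in an additive type with a scalar multiplication by complex
  numbers, meaningful for scalars in \<open>k\<close>. Linear automorphisms of \<open>V\<close> are extensional functions,
  so that two of them are equal as soon as they agree on \<open>V\<close>.\<close>

definition GL :: "complex set \<Rightarrow> (complex \<Rightarrow> 'v \<Rightarrow> 'v) \<Rightarrow> 'v::ab_group_add set \<Rightarrow> ('v \<Rightarrow> 'v) monoid"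
  where "GL k sc V = (BijGroup V)\<lparr>carrier := {g \<in> Bij V.
    (\<forall>x\<in>V. \<forall>y\<in>V. g (x + y) = g x + g y) \<and> (\<forall>c\<in>k. \<forall>x\<in>V. g (sc c x) = sc c (g x))}\<rparr>"

definition hyperplane ::
    "complex set \<Rightarrow> (complex \<Rightarrow> 'v \<Rightarrow> 'v) \<Rightarrow> 'v::ab_group_add set \<Rightarrow> 'v set \<Rightarrow> bool"
  where "hyperplane k sc V U \<longleftrightarrow>
    U \<subseteq> V \<and> lincomb k sc U = U \<and> (\<exists>v\<in>V - U. lincomb k sc (insert v U) = V)"

definition reflection ::
    "complex set \<Rightarrow> (complex \<Rightarrow> 'v \<Rightarrow> 'v) \<Rightarrow> 'v::ab_group_add set \<Rightarrow> ('v \<Rightarrow> 'v) \<Rightarrow> bool"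
  where "reflection k sc V s \<longleftrightarrow>
    s \<in> carrier (GL k sc V) \<and>
    (\<exists>n::nat. n > 0 \<and> s [^]\<^bsub>GL k sc V\<^esub> n = \<one>\<^bsub>GL k sc V\<^esub>) \<and>
    hyperplane k sc V {v \<in> V. s v = v}"

section \<open>Root systems\<close>

text \<open>Two finite-dimensional \<open>k\<close>-vector spaces \<open>V\<close>, \<open>W\<close> with a pairing that is linear in the first
  and semilinear in the second argument. The record carries only the data.\<close>

record ('v, 'w) hermitian_pair =
  base :: "complex set"
  scaleV :: "complex \<Rightarrow> 'v \<Rightarrow> 'v"
  spaceV :: "'v set"
  scaleW :: "complex \<Rightarrow> 'w \<Rightarrow> 'w"
  spaceW :: "'w set"
  pairing :: "'v \<Rightarrow> 'w \<Rightarrow> complex"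

abbreviation GLV :: "('v::ab_group_add, 'w::ab_group_add) hermitian_pair \<Rightarrow> ('v \<Rightarrow> 'v) monoid"
  where "GLV H \<equiv> GL (base H) (scaleV H) (spaceV H)"

abbreviation GLW :: "('v::ab_group_add, 'w::ab_group_add) hermitian_pair \<Rightarrow> ('w \<Rightarrow> 'w) monoid"
  where "GLW H \<equiv> GL (base H) (scaleW H) (spaceW H)"

definition dual_map ::
    "('v::ab_group_add, 'w::ab_group_add) hermitian_pair \<Rightarrow> ('v \<Rightarrow> 'v) \<Rightarrow> 'w \<Rightarrow> 'w"
  where "dual_map H g = (THE h. h \<in> carrier (GLW H) \<and>
    (\<forall>v\<in>spaceV H. \<forall>w\<in>spaceW H. pairing H (g v) (h w) = pairing H v w))"

text \<open>\<open>\<langle>I, J\<rangle>\<close>: the \<open>\<int>\<^sub>k\<close>-module generated by all values of the pairing.\<close>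

definition pairing_ideal ::
    "('v::ab_group_add, 'w::ab_group_add) hermitian_pair \<Rightarrow> 'v set \<Rightarrow> 'w set \<Rightarrow> complex set"
  where "pairing_ideal H I J =
    lincomb (integers_of (base H)) (*) {pairing H \<alpha> \<beta> | \<alpha> \<beta>. \<alpha> \<in> I \<and> \<beta> \<in> J}"

text \<open>A finitely generated \<open>\<int>\<^sub>k\<close>-submodule \<open>M\<close> of a \<open>k\<close>-vector space is torsion free, so its rank
  is the dimension of \<open>kM\<close>.\<close>

definition rank_one ::
    "complex set \<Rightarrow> (complex \<Rightarrow> 'v \<Rightarrow> 'v) \<Rightarrow> 'v::ab_group_add set \<Rightarrow> bool"
  where "rank_one k sc M \<longleftrightarrow> (\<exists>v. v \<noteq> 0 \<and> lincomb k sc M = (\<lambda>c. sc c v) ` k)"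

type_synonym ('v, 'w) root = "'v set \<times> 'w set \<times> complex"

definition is_root ::
    "('v::ab_group_add, 'w::ab_group_add) hermitian_pair \<Rightarrow> ('v, 'w) root \<Rightarrow> bool"
  where "is_root H = (\<lambda>(I, J, \<xi>).
    fg_submodule (integers_of (base H)) (scaleV H) (spaceV H) I \<and>
    rank_one (base H) (scaleV H) I \<and>
    fg_submodule (integers_of (base H)) (scaleW H) (spaceW H) J \<and>
    rank_one (base H) (scaleW H) J \<and>
    \<xi> \<in> base H \<and> \<xi> \<noteq> 1 \<and> (\<exists>n::nat. n > 0 \<and> \<xi> ^ n = 1) \<and>
    pairing_ideal H I J = (1 - \<xi>) *o integers_of (base H))"

definition root_reflection ::
    "('v::ab_group_add, 'w::ab_group_add) hermitian_pair \<Rightarrow> ('v, 'w) root \<Rightarrow> 'v \<Rightarrow> 'v"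
  where "root_reflection H = (\<lambda>(I, J, \<xi>).
    THE s. \<exists>v \<in> lincomb (base H) (scaleV H) I. \<exists>w \<in> lincomb (base H) (scaleW H) J.
      pairing H v w = 1 - \<xi> \<and> s = (\<lambda>x\<in>spaceV H. x - scaleV H (pairing H x w) v))"

definition act ::
    "('v::ab_group_add, 'w::ab_group_add) hermitian_pair \<Rightarrow> ('v \<Rightarrow> 'v) \<Rightarrow>
      ('v, 'w) root \<Rightarrow> ('v, 'w) root"
  where "act H g = (\<lambda>(I, J, \<xi>). (g ` I, dual_map H g ` J, \<xi>))"

definition ideal_act ::
    "('v::ab_group_add, 'w::ab_group_add) hermitian_pair \<Rightarrow> complex set \<Rightarrow>
      ('v, 'w) root \<Rightarrow> ('v, 'w) root"
  where "ideal_act H \<aa> = (\<lambda>(I, J, \<xi>).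
    (lincomb \<aa> (scaleV H) I, lincomb (frac_inverse_conj (base H) \<aa>) (scaleW H) J, \<xi>))"

definition root_system ::
    "('v::ab_group_add, 'w::ab_group_add) hermitian_pair \<Rightarrow> ('v, 'w) root set \<Rightarrow> bool"
  where "root_system H \<RR> \<longleftrightarrow>
    finite \<RR> \<and> (\<forall>r\<in>\<RR>. is_root H r) \<and>
    lincomb (base H) (scaleV H) (\<Union>r\<in>\<RR>. fst r) = spaceV H \<and>
    (\<forall>r\<in>\<RR>. act H (root_reflection H r) ` \<RR> = \<RR>) \<and>
    (\<forall>r1\<in>\<RR>. \<forall>r2\<in>\<RR>. pairing_ideal H (fst r1) (fst (snd r2)) \<subseteq> integers_of (base H))"

definition root_system_for ::
    "('v::ab_group_add, 'w::ab_group_add) hermitian_pair \<Rightarrow> ('v \<Rightarrow> 'v) set \<Rightarrow>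
      ('v, 'w) root set \<Rightarrow> bool"
  where "root_system_for H G \<RR> \<longleftrightarrow>
    root_system H \<RR> \<and> generate (GLV H) (root_reflection H ` \<RR>) = G"

definition is_reduced ::
    "('v::ab_group_add, 'w::ab_group_add) hermitian_pair \<Rightarrow> ('v, 'w) root set \<Rightarrow> bool"
  where "is_reduced H \<RR> \<longleftrightarrow> inj_on (root_reflection H) \<RR>"

definition is_complete ::
    "('v::ab_group_add, 'w::ab_group_add) hermitian_pair \<Rightarrow> ('v \<Rightarrow> 'v) set \<Rightarrow>
      ('v, 'w) root set \<Rightarrow> bool"
  where "is_complete H G \<RR> \<longleftrightarrow>
    (\<forall>s\<in>G. reflection (base H) (scaleV H) (spaceV H) s \<longrightarrow> s \<in> root_reflection H ` \<RR>)"

definition complete_reduced_root_systems ::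
    "('v::ab_group_add, 'w::ab_group_add) hermitian_pair \<Rightarrow> ('v \<Rightarrow> 'v) set \<Rightarrow>
      ('v, 'w) root set set"
  where "complete_reduced_root_systems H G =
    {\<RR>. root_system_for H G \<RR> \<and> is_reduced H \<RR> \<and> is_complete H G \<RR>}"

definition same_genus ::
    "('v::ab_group_add, 'w::ab_group_add) hermitian_pair \<Rightarrow>
      ('v, 'w) root set \<Rightarrow> ('v, 'w) root set \<Rightarrow> bool"
  where "same_genus H \<RR>1 \<RR>2 \<longleftrightarrow>
    (\<exists>\<aa>. fractional_ideal (base H) \<aa> \<and> \<RR>2 = ideal_act H \<aa> ` \<RR>1)"

section \<open>The cyclic group of order \<open>d\<close> acting on \<open>k\<close>\<close>

definition standard_pair :: "complex set \<Rightarrow> (complex, complex) hermitian_pair"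
  where "standard_pair k = \<lparr>base = k, scaleV = (*), spaceV = k, scaleW = (*), spaceW = k,
    pairing = (\<lambda>a b. a * cnj b)\<rparr>"

definition roots_of_unity :: "nat \<Rightarrow> complex set"
  where "roots_of_unity d = {z. z ^ d = 1}"

definition mu_action :: "complex set \<Rightarrow> nat \<Rightarrow> (complex \<Rightarrow> complex) set"
  where "mu_action k d = (\<lambda>z. \<lambda>x\<in>k. z * x) ` roots_of_unity d"

definition zeta :: "nat \<Rightarrow> complex"
  where "zeta d = exp (2 * complex_of_real pi * \<i> / of_nat d)"

definition ideal_families :: "complex set \<Rightarrow> nat \<Rightarrow> (nat \<Rightarrow> complex set) set"
  where "ideal_families k d = (\<Pi>\<^sub>E j\<in>{1..d - 1}.
    {\<aa>. ideal \<aa> (integer_ring k) \<and> ideal_divides k \<aa> ((1 - zeta d ^ j) *o integers_of k)})"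

text \<open>The sum of sets is the elementwise one, so this says \<open>\<aa>\<^sub>1 + \<dots> + \<aa>\<^sub>d\<^sub>-\<^sub>1 = \<int>\<^sub>k\<close>.\<close>

definition coprime_ideal_families :: "complex set \<Rightarrow> nat \<Rightarrow> (nat \<Rightarrow> complex set) set"
  where "coprime_ideal_families k d =
    {\<FF> \<in> ideal_families k d. (\<Sum>j\<in>{1..d - 1}. \<FF> j) = integers_of k}"

definition family_root_system ::
    "complex set \<Rightarrow> nat \<Rightarrow> (nat \<Rightarrow> complex set) \<Rightarrow> (complex, complex) root set"
  where "family_root_system k d \<FF> =
    {(\<FF> j, cnj (1 - zeta d ^ j) *o frac_inverse_conj k (\<FF> j), zeta d ^ j) | j. j \<in> {1..d - 1}}"

end

theory Submission
  imports Defs "Jordan_Normal_Form.Char_Poly"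
begin

text \<open>A reflection of \<open>V = k\<close> is multiplication by a root of unity, so a root is a triple
  \<open>(I, J, \<xi>)\<close> with \<open>I J\<^sup>* = (1 - \<xi>) \<int>\<^sub>k\<close>, and its reflection is multiplication by \<open>\<xi>\<close>. The
  reflections of \<open>G\<close> fix every root. Hence a complete reduced root system for \<open>G\<close> amounts to
  modules \<open>I\<^sub>j\<close>, \<open>D\<^sub>j = J\<^sub>j\<^sup>*\<close> with \<open>I\<^sub>j D\<^sub>j = (1 - \<zeta>\<^sup>j) \<int>\<^sub>k\<close> and \<open>I\<^sub>i D\<^sub>j \<subseteq> \<int>\<^sub>k\<close>. With
  \<open>\<bb> = I\<^sub>1 + \<dots> + I\<^sub>d\<^sub>-\<^sub>1\<close>, the ideals \<open>\<bb>\<^sup>-\<^sup>1 I\<^sub>j\<close> form the coprime family in its genus: their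
  complementary divisors in \<open>(1 - \<zeta>\<^sup>j) \<int>\<^sub>k\<close> are the ideals \<open>\<bb> D\<^sub>j\<close>. The family is unique because summing
  \<open>\<aa> \<FF>\<^sub>j = I\<^sub>j\<close> over \<open>j\<close> recovers \<open>\<aa> = \<bb>\<close>.

  The only arithmetic input is that a nonzero finitely generated \<open>\<int>\<^sub>k\<close>-submodule of \<open>k\<close> is invertible.
  If its generators are the coefficients of \<open>f \<in> k[x]\<close>, then \<open>f\<close> is integral over \<open>\<rat>[x]\<close>, so some
  multiple \<open>f b\<close> with \<open>b \<in> k[x]\<close> is a primitive integer polynomial, and Dedekind's Prague theorem
  makes all products of a coefficient of \<open>f\<close> and one of \<open>b\<close> integral.\<close>

section \<open>Products of additive groups\<close>

text \<open>The module product when \<open>A\<close> and \<open>B\<close> are modules, and the span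
  of \<open>B\<close> when \<open>A\<close> is a ring of scalars. As an inductive closure it turns
  the laws of products into inductions instead of manipulations of finite sums. Zero is not built
  in: an empty factor gives an empty product, hence the nonemptiness conditions on generating sets
  further on.\<close>

inductive_set mprod :: "'a::idom set \<Rightarrow> 'a set \<Rightarrow> 'a set" for A B where
  mult: "a \<in> A \<Longrightarrow> b \<in> B \<Longrightarrow> a * b \<in> mprod A B"
| add: "x \<in> mprod A B \<Longrightarrow> y \<in> mprod A B \<Longrightarrow> x + y \<in> mprod A B"

lemma mprod_least:
  assumes "\<And>a b. a \<in> A \<Longrightarrow> b \<in> B \<Longrightarrow> a * b \<in> M" "\<And>x y. x \<in> M \<Longrightarrow> y \<in> M \<Longrightarrow> x + y \<in> M"
  shows "mprod A B \<subseteq> M"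
proof
  fix x assume "x \<in> mprod A B"
  then show "x \<in> M" by induction (use assms in auto)
qed

lemma mprod_mono: "A \<subseteq> A' \<Longrightarrow> B \<subseteq> B' \<Longrightarrow> mprod A B \<subseteq> mprod A' B'"
  by (intro mprod_least) (auto intro: mprod.intros)

lemma mprod_commute: "mprod A B = mprod B A"
proof -
  have "a * b \<in> mprod B A" if "a \<in> A" "b \<in> B" for a b and A B :: "'a set"
    using mprod.mult[OF that(2,1)] by (simp add: mult.commute)
  then have "mprod A B \<subseteq> mprod B A" for A B :: "'a set"
    by (intro mprod_least) (blast intro: mprod.add)+
  then show ?thesis by blast
qed

lemma mprod_assoc: "mprod (mprod A B) C = mprod A (mprod B C)"
proof
  have "x * c \<in> mprod A (mprod B C)" if "x \<in> mprod A B" "c \<in> C" for x c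
    using that(1)
    by induction (use that(2) in \<open>auto simp: mult.assoc distrib_right intro: mprod.intros\<close>)
  then show "mprod (mprod A B) C \<subseteq> mprod A (mprod B C)"
    by (intro mprod_least) (auto intro: mprod.add)
  have "a * x \<in> mprod (mprod A B) C" if "x \<in> mprod B C" "a \<in> A" for x a
    using that(1)
    by induction (use that(2) in \<open>auto simp: mult.assoc[symmetric] distrib_left intro: mprod.intros\<close>)
  then show "mprod A (mprod B C) \<subseteq> mprod (mprod A B) C"
    by (intro mprod_least) (auto intro: mprod.add)
qed

lemma mprod_left_commute: "mprod A (mprod B C) = mprod B (mprod A C)"
  by (metis mprod_assoc mprod_commute)

lemma zero_in_mprod: "0 \<in> A \<Longrightarrow> b \<in> B \<Longrightarrow> 0 \<in> mprod A B"
  using mprod.mult[of 0 A b B] by simp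

lemma uminus_in_mprod:
  assumes "x \<in> mprod A B" "\<And>a. a \<in> A \<Longrightarrow> - a \<in> A"
  shows "- x \<in> mprod A B"
  using assms(1)
proof induction
  case (mult a b)
  then show ?case using assms(2) mprod.mult[of "- a" A b B] by simp
next
  case (add x y)
  then show ?case using mprod.add[of "- x" A B "- y"] by (simp add: algebra_simps)
qed

lemma sum_in_mprod:
  assumes "\<And>i. i \<in> F \<Longrightarrow> f i \<in> mprod A B" "0 \<in> mprod A B"
  shows "sum f F \<in> mprod A B"
  using assms by (induction F rule: infinite_finite_induct) (auto intro: mprod.add)

text \<open>Terms with the same generator are collected, leaving one coefficient per generator.
  These coefficients become the rows of a matrix in the determinant trick.\<close>

lemma mprod_finite_expansion:
  assumes "x \<in> mprod A S" "finite S" "0 \<in> A" "\<And>a b. a \<in> A \<Longrightarrow> b \<in> A \<Longrightarrow> a + b \<in> A"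
  obtains c where "c ` S \<subseteq> A" "x = (\<Sum>s\<in>S. c s * s)"
proof -
  have "\<exists>c. c ` S \<subseteq> A \<and> x = (\<Sum>s\<in>S. c s * s)"
    using assms(1)
  proof induction
    case (mult a b)
    have "(\<Sum>s\<in>S. (if s = b then a else 0) * s) = (\<Sum>s\<in>S. if s = b then a * b else 0)"
      by (intro sum.cong) auto
    also have "\<dots> = a * b" using mult assms(2) by simp
    finally show ?case
      using mult assms(3) by (intro exI[of _ "\<lambda>s. if s = b then a else 0"]) auto
  next
    case (add x y)
    then obtain c d where "c ` S \<subseteq> A" "x = (\<Sum>s\<in>S. c s * s)" "d ` S \<subseteq> A" "y = (\<Sum>s\<in>S. d s * s)"
      by blast
    then show ?case using assms(4)
      by (intro exI[of _ "\<lambda>s. c s + d s"]) (auto simp: distrib_right sum.distrib)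
  qed
  then show ?thesis using that by blast
qed

section \<open>Integral elements\<close>

text \<open>A predicate on sets in any integral domain, since it is applied both to numbers and to
  polynomials.\<close>

definition subring_set :: "'a::idom set \<Rightarrow> bool"
  where "subring_set A \<longleftrightarrow> 1 \<in> A \<and> (\<forall>x\<in>A. \<forall>y\<in>A. x - y \<in> A \<and> x * y \<in> A)"

lemma subring_setD:
  assumes "subring_set A"
  shows "1 \<in> A" "0 \<in> A" "x \<in> A \<Longrightarrow> - x \<in> A" "x \<in> A \<Longrightarrow> y \<in> A \<Longrightarrow> x - y \<in> A"
    "x \<in> A \<Longrightarrow> y \<in> A \<Longrightarrow> x + y \<in> A" "x \<in> A \<Longrightarrow> y \<in> A \<Longrightarrow> x * y \<in> A"
proof -
  note A = assms[unfolded subring_set_def]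
  show "1 \<in> A" and sub: "\<And>x y. x \<in> A \<Longrightarrow> y \<in> A \<Longrightarrow> x - y \<in> A"
    and "x \<in> A \<Longrightarrow> y \<in> A \<Longrightarrow> x * y \<in> A" using A by blast+
  then show "0 \<in> A" by (metis diff_self)
  then show min: "- x \<in> A" if "x \<in> A" for x using sub[of 0 x] that by simp
  then show "x \<in> A \<Longrightarrow> y \<in> A \<Longrightarrow> x + y \<in> A" using sub[of x "- y"] by simp
qed

lemma subring_set_sum: "subring_set A \<Longrightarrow> (\<And>i. i \<in> F \<Longrightarrow> f i \<in> A) \<Longrightarrow> sum f F \<in> A"
  by (induction F rule: infinite_finite_induct) (auto simp: subring_setD)

lemma subring_set_prod: "subring_set A \<Longrightarrow> (\<And>i. i \<in> F \<Longrightarrow> f i \<in> A) \<Longrightarrow> prod f F \<in> A"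
  by (induction F rule: infinite_finite_induct) (auto simp: subring_setD)

lemma subring_set_power: "subring_set A \<Longrightarrow> x \<in> A \<Longrightarrow> x ^ n \<in> A"
  by (induction n) (auto simp: subring_setD)

lemma subring_set_polys: "subring_set A \<Longrightarrow> subring_set {p. \<forall>i. coeff p i \<in> A}"
  unfolding subring_set_def[of "{p. \<forall>i. coeff p i \<in> A}"]
  by (auto simp: subring_setD coeff_mult intro!: subring_set_sum)

text \<open>By the Leibniz formula a determinant is a signed sum of products of entries.\<close>

lemma subring_set_det:
  assumes "subring_set A" "M \<in> carrier_mat n n" "\<And>i j. i < n \<Longrightarrow> j < n \<Longrightarrow> M $$ (i, j) \<in> A"
  shows "det M \<in> A"
proof -
  have "signof p * (\<Prod>i = 0..<n. M $$ (i, p i)) \<in> A" if "p permutes {0..<n}" for p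
    using assms(1,3) that
    by (intro subring_setD(6) subring_set_prod)
       (auto simp: sign_def subring_setD permutes_in_image[OF that])
  then show ?thesis
    using assms by (auto simp: det_def intro!: subring_set_sum)
qed

definition integral_over :: "'a::idom set \<Rightarrow> 'a \<Rightarrow> bool"
  where "integral_over A x \<longleftrightarrow> (\<exists>p. lead_coeff p = 1 \<and> (\<forall>i. coeff p i \<in> A) \<and> poly p x = 0)"

lemma integral_over_mono: "integral_over A x \<Longrightarrow> A \<subseteq> B \<Longrightarrow> integral_over B x"
  unfolding integral_over_def by blast

lemma poly_char_poly:
  fixes M :: "'a :: idom mat"
  assumes "M \<in> carrier_mat n n"
  shows "poly (char_poly M) x = det (x \<cdot>\<^sub>m 1\<^sub>m n - M)"
  unfolding char_poly_def
  by (rule poly_det_cong[of _ n]) (use assms in \<open>auto simp: char_poly_matrix_def\<close>)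

text \<open>The determinant trick: the characteristic polynomial of \<open>c\<close> is a monic equation for \<open>x\<close>.\<close>

lemma integral_over_of_matrix:
  fixes x :: "'a :: idom" and n :: nat
  assumes A: "subring_set A"
    and c: "\<And>i j. i < n \<Longrightarrow> j < n \<Longrightarrow> c i j \<in> A"
    and x: "\<And>i. i < n \<Longrightarrow> x * v i = (\<Sum>j<n. c i j * v j)"
    and l: "l < n" "v l \<noteq> 0"
  shows "integral_over A x"
proof -
  define M where "M = mat n n (\<lambda>(i, j). c i j)"
  have M: "M \<in> carrier_mat n n" by (simp add: M_def)
  define N where "N = x \<cdot>\<^sub>m 1\<^sub>m n - M"
  have N: "N \<in> carrier_mat n n" unfolding N_def using M by (rule minus_carrier_mat)
  define w where "w = vec n v"
  have w: "w \<in> carrier_vec n" by (simp add: w_def)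
  have "N *\<^sub>v w = 0\<^sub>v n"
  proof (rule eq_vecI)
    fix i assume "i < dim_vec (0\<^sub>v n :: 'a vec)"
    then have i: "i < n" by simp
    have "(N *\<^sub>v w) $ i = (\<Sum>j = 0..<n. (if i = j then x * v j else 0) - c i j * v j)"
      using i M by (auto simp: N_def M_def w_def scalar_prod_def algebra_simps intro!: sum.cong)
    also have "\<dots> = x * v i - (\<Sum>j<n. c i j * v j)"
      using i by (simp add: sum_subtractf lessThan_atLeast0)
    finally show "(N *\<^sub>v w) $ i = 0\<^sub>v n $ i" using x[OF i] i by simp
  qed (use N in auto)
  \<comment> \<open>The vector \<open>w\<close> lies in the kernel of \<open>N\<close>. Multiplying
    by the adjugate gives \<open>det N\<close> times \<open>w\<close>, and the nonzero entry at
    \<open>l\<close> then forces \<open>det N = 0\<close>.\<close>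
  then have "(adj_mat N * N) *\<^sub>v w = 0\<^sub>v n"
    using assoc_mult_mat_vec[OF adj_mat(1)[OF N] N w] adj_mat(1)[OF N]
    by (auto simp: scalar_prod_def intro!: eq_vecI)
  then have "(det N \<cdot>\<^sub>m 1\<^sub>m n *\<^sub>v w) $ l = 0"
    using adj_mat(3)[OF N] l by simp
  moreover have "(det N \<cdot>\<^sub>m 1\<^sub>m n *\<^sub>v w) $ l
      = (\<Sum>j = 0..<n. det N * (if j = l then 1 else 0) * v j)"
    using l by (simp add: scalar_prod_def w_def)
  moreover have "\<dots> = (\<Sum>j = 0..<n. if j = l then det N * v j else 0)"
    by (intro sum.cong) auto
  ultimately have "det N = 0" using l by simp
  then have "poly (char_poly M) x = 0"
    using poly_char_poly[OF M] by (simp add: N_def)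
  moreover have "char_poly M \<in> {p. \<forall>i. coeff p i \<in> A}"
    unfolding char_poly_def
    by (rule subring_set_det[OF subring_set_polys[OF A], of _ n])
       (use M c A in \<open>auto simp: char_poly_matrix_def M_def subring_setD coeff_pCons split: nat.split\<close>)
  ultimately show ?thesis
    using degree_monic_char_poly[OF M] by (auto simp: integral_over_def)
qed

text \<open>Numbering \<open>S\<close> and expanding every \<open>x * s\<close> in the generators
  gives the matrix for the determinant trick; \<open>s0\<close> is the nonzero entry of its kernel
  vector.\<close>

lemma integral_over_of_finite:
  assumes A: "subring_set A" and S: "finite S" "s0 \<in> S" "s0 \<noteq> 0"
    and x: "\<And>s. s \<in> S \<Longrightarrow> x * s \<in> mprod A S"
  shows "integral_over A x"
proof -
  obtain e where e: "bij_betw e {..<card S} S"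
    using ex_bij_betw_nat_finite[OF S(1)] by (auto simp: lessThan_atLeast0)
  have "\<forall>i\<in>{..<card S}. \<exists>c. c ` S \<subseteq> A \<and> x * e i = (\<Sum>s\<in>S. c s * s)"
  proof
    fix i assume "i \<in> {..<card S}"
    with e have "e i \<in> S" by (rule bij_betw_apply)
    then show "\<exists>c. c ` S \<subseteq> A \<and> x * e i = (\<Sum>s\<in>S. c s * s)"
      using mprod_finite_expansion[OF x S(1) subring_setD(2,5)[OF A]] by blast
  qed
  then obtain c where "\<forall>i\<in>{..<card S}. c i ` S \<subseteq> A \<and> x * e i = (\<Sum>s\<in>S. c i s * s)"
    by (rule bchoice[THEN exE])
  then have c: "c i ` S \<subseteq> A" "x * e i = (\<Sum>s\<in>S. c i s * s)" if "i < card S" for i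
    using that by auto
  from S(2) have "s0 \<in> e ` {..<card S}" using e by (simp add: bij_betw_def)
  then obtain l where l: "l < card S" "e l = s0" by auto
  show ?thesis
  proof (rule integral_over_of_matrix[OF A, where n = "card S" and v = e and c = "\<lambda>i j. c i (e j)"])
    show "c i (e j) \<in> A" if "i < card S" "j < card S" for i j
      using c(1)[OF that(1)] bij_betwE[OF e] that(2) by blast
    show "x * e i = (\<Sum>j<card S. c i (e j) * e j)" if "i < card S" for i
      using c(2)[OF that] sum.reindex_bij_betw[OF e, of "\<lambda>s. c i s * s"] by simp
  qed (use l S in auto)
qed

text \<open>A ring that is finitely generated as a module over \<open>A\<close>. Additive closure is
  already part of \<open>mprod\<close>, so only the unit and products are demanded.\<close>

definition integral_extension :: "'a::idom set \<Rightarrow> 'a set \<Rightarrow> bool"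
  where "integral_extension A T \<longleftrightarrow>
    (\<exists>S. finite S \<and> T = mprod A S) \<and> 1 \<in> T \<and> (\<forall>x\<in>T. \<forall>y\<in>T. x * y \<in> T)"

lemma integral_extension_subring:
  assumes "subring_set A" "integral_extension A T"
  shows "subring_set T"
proof -
  from assms(2) obtain S where T: "T = mprod A S" unfolding integral_extension_def by blast
  have "x - y \<in> T" if "x \<in> T" "y \<in> T" for x y
    using mprod.add[of x A S "- y"] uminus_in_mprod[of y A S] subring_setD(3)[OF assms(1)] that
    by (simp add: T)
  then show ?thesis using assms(2) by (simp add: subring_set_def integral_extension_def)
qed

lemma integral_extension_supset:
  assumes "subring_set A" "integral_extension A T"
  shows "A \<subseteq> T"
proof -
  from assms(2) obtain S where T: "T = mprod A S" unfolding integral_extension_def by blast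
  have "a * x \<in> T" if "x \<in> mprod A S" "a \<in> A" for x a
    using that(1)
  proof induction
    case (mult b s)
    then show ?case using mprod.mult[of "a * b" A s S] subring_setD(6)[OF assms(1) that(2)]
      by (simp add: T mult.assoc)
  next
    case (add x y)
    then show ?case by (simp add: T distrib_left mprod.add)
  qed
  from this[of 1] show ?thesis using assms(2) by (auto simp: T integral_extension_def)
qed

text \<open>Multiplication by \<open>x\<close> maps the generators of \<open>T\<close> into
  \<open>T\<close>. Not all of them vanish because \<open>1 \<in> T\<close>.\<close>

lemma integral_over_of_extension:
  assumes A: "subring_set A" and T: "integral_extension A T" and "x \<in> T"
  shows "integral_over A x"
proof -
  from T obtain S where S: "finite S" "T = mprod A S" unfolding integral_extension_def by blast
  have "\<not> S \<subseteq> {0}"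
  proof
    assume "S \<subseteq> {0}"
    then have "mprod A S \<subseteq> {0}" by (intro mprod_least) auto
    then show False using T by (auto simp: S integral_extension_def)
  qed
  then obtain s0 where "s0 \<in> S" "s0 \<noteq> 0" by auto
  moreover have "x * s \<in> mprod A S" if "s \<in> S" for s
    using T \<open>x \<in> T\<close> mprod.mult[OF subring_setD(1)[OF A] that]
    by (simp add: S integral_extension_def)
  ultimately show ?thesis using integral_over_of_finite[OF A S(1)] by blast
qed

text \<open>The extension generated by the powers of \<open>r\<close> below the degree of its equation.\<close>

lemma integral_extension_adjoin:
  assumes A: "subring_set A" and T: "integral_extension A T" and r: "integral_over T r"
  shows "\<exists>T'. integral_extension A T' \<and> T \<subseteq> T' \<and> r \<in> T'"
proof -
  note T_ring = integral_extension_subring[OF A T]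
  from T obtain S where S: "finite S" "T = mprod A S" unfolding integral_extension_def by blast
  from r obtain p where p: "lead_coeff p = 1" "\<forall>i. coeff p i \<in> T" "poly p r = 0"
    unfolding integral_over_def by blast
  define n where "n = degree p"
  define R where "R = (\<lambda>i. r ^ i) ` {..<n}"
  define T' where "T' = mprod T R"
  \<comment> \<open>A monic constant would be \<open>1\<close>, which has no root. Positive degree
    puts \<open>r ^ 0 = 1\<close> into \<open>R\<close>.\<close>
  have "n > 0"
  proof (rule ccontr)
    assume "\<not> n > 0"
    then have "p = 1" using p(1) by (auto simp: n_def elim!: degree_eq_zeroE)
    then show False using p(3) by simp
  qed
  then have "1 \<in> R" unfolding R_def by (intro image_eqI[of _ _ 0]) auto
  have TT': "T \<subseteq> T'"
    using mprod.mult[OF _ \<open>1 \<in> R\<close>, of _ T] by (auto simp: T'_def)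
  have T'_scale: "t * x \<in> T'" if "x \<in> T'" "t \<in> T" for t x
  proof -
    have "t * x \<in> mprod T (mprod T R)" using that by (auto simp: T'_def intro: mprod.mult)
    also have "\<dots> = mprod (mprod T T) R" by (simp add: mprod_assoc)
    also have "\<dots> \<subseteq> T'" unfolding T'_def
      by (intro mprod_mono mprod_least) (auto simp: subring_setD[OF T_ring])
    finally show ?thesis .
  qed
  have T'_add: "x + y \<in> T'" if "x \<in> T'" "y \<in> T'" for x y
    using that by (auto simp: T'_def intro: mprod.add)
  have "0 \<in> T'" using TT' subring_setD(2)[OF T_ring] by blast
  \<comment> \<open>The monic equation expresses the first power missing from \<open>R\<close> by
    the lower ones.\<close>
  have rn: "r ^ n \<in> T'"
  proof -
    have "r ^ n = - (\<Sum>i<n. coeff p i * r ^ i)"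
      using p(1,3) by (simp add: poly_altdef n_def[symmetric] lessThan_Suc_atMost[symmetric]
          eq_neg_iff_add_eq_0 add.commute)
    also have "\<dots> = (\<Sum>i<n. (- coeff p i) * r ^ i)" by (simp add: sum_negf)
    also have "\<dots> \<in> T'" unfolding T'_def
      by (intro sum_in_mprod mprod.mult)
         (use p(2) \<open>0 \<in> T'\<close> T'_def in \<open>auto simp: R_def subring_setD[OF T_ring]\<close>)
    finally show ?thesis .
  qed
  \<comment> \<open>Multiplication by \<open>r\<close> raises exponents by one; only the top power
    leaves \<open>R\<close>, and \<open>rn\<close> brings it back into \<open>T'\<close>.\<close>
  have r_scale: "r * x \<in> T'" if "x \<in> T'" for x
    using that unfolding T'_def
  proof induction
    case (mult t s)
    then obtain i where i: "i < n" "s = r ^ i" by (auto simp: R_def)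
    have "r ^ Suc i \<in> T'"
    proof (cases "Suc i < n")
      case True
      then have "1 * r ^ Suc i \<in> T'" unfolding T'_def
        by (intro mprod.mult) (auto simp: R_def subring_setD[OF T_ring] simp del: power_Suc)
      then show ?thesis by simp
    next
      case False
      then show ?thesis using i rn by (metis not_less_eq linorder_neqE_nat)
    qed
    then show ?case using T'_scale[OF _ mult(1), of "r ^ Suc i"] i
      by (simp add: T'_def mult_ac)
  next
    case (add x y)
    then show ?case by (simp add: distrib_left mprod.add)
  qed
  have rpow: "r ^ i * x \<in> T'" if "x \<in> T'" for x i
    by (induction i) (use that r_scale in \<open>auto simp: mult.assoc\<close>)
  have "y * x \<in> T'" if "y \<in> T'" "x \<in> T'" for x y
    using that(1) unfolding T'_def
  proof induction
    case (mult t s)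
    then show ?case using T'_scale[OF rpow[OF that(2)] mult(1)]
      by (auto simp: R_def T'_def mult.assoc)
  next
    case (add y z)
    then show ?case by (simp add: distrib_right mprod.add)
  qed
  moreover have "T' = mprod A (mprod S R)" by (simp add: T'_def S mprod_assoc)
  \<comment> \<open>\<open>mprod S R\<close> is closed under addition and so need not be finite. The
    finitely many products \<open>s * t\<close> generate the same module over
    \<open>A\<close>.\<close>
  moreover have "mprod A (mprod S R) = mprod A {s * t |s t. s \<in> S \<and> t \<in> R}"
  proof
    have scale: "a * x \<in> mprod A {s * t |s t. s \<in> S \<and> t \<in> R}" if "x \<in> mprod S R" "a \<in> A" for a x
      using that(1)
      by induction (use that(2) in \<open>auto simp: distrib_left intro!: mprod.mult intro: mprod.add\<close>)
    show "mprod A (mprod S R) \<subseteq> mprod A {s * t |s t. s \<in> S \<and> t \<in> R}"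
      by (intro mprod_least) (auto intro: scale mprod.add)
  qed (intro mprod_mono, auto intro: mprod.mult)
  moreover have "finite {s * t |s t. s \<in> S \<and> t \<in> R}"
    using finite_image_set2[of "\<lambda>s. s \<in> S" "\<lambda>t. t \<in> R"] S(1) by (simp add: R_def)
  moreover have "r \<in> T'" using r_scale[of 1] TT' subring_setD(1)[OF T_ring] by auto
  ultimately have "integral_extension A T' \<and> T \<subseteq> T' \<and> r \<in> T'"
    unfolding integral_extension_def using TT' subring_setD(1)[OF T_ring] by blast
  then show ?thesis by blast
qed

text \<open>The elements are adjoined one at a time, starting from \<open>A\<close> itself, which is
  generated by \<open>1\<close>.\<close>

lemma integral_extension_finite:
  assumes A: "subring_set A" and B: "finite B" "\<And>x. x \<in> B \<Longrightarrow> integral_over A x"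
  shows "\<exists>T. integral_extension A T \<and> B \<subseteq> T"
  using B
proof (induction B rule: finite_induct)
  case empty
  have "mprod A {1} = A"
    using mprod.mult[of _ A 1 "{1}"] mprod_least[of A "{1}" A] subring_setD[OF A] by auto
  then have "integral_extension A A"
    unfolding integral_extension_def using subring_setD[OF A] by (metis finite.intros)
  then show ?case by blast
next
  case (insert x B)
  then obtain T where T: "integral_extension A T" "B \<subseteq> T" by auto
  have "integral_over T x"
    using insert.prems integral_over_mono integral_extension_supset[OF A T(1)] by blast
  with integral_extension_adjoin[OF A T(1)] T(2) show ?case by blast
qed

text \<open>Two integral elements lie in a common finite extension; their difference and product lie
  there too, and everything in it is integral.\<close>

lemma subring_set_integral_closure:
  assumes A: "subring_set A"
  shows "subring_set {x. integral_over A x}"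
  unfolding subring_set_def[of "{x. integral_over A x}"]
proof (intro conjI ballI)
  show "1 \<in> {x. integral_over A x}"
    using subring_setD[OF A]
    by (auto simp: integral_over_def coeff_pCons split: nat.split intro!: exI[of _ "[:-1, 1:]"])
next
  fix x y assume "x \<in> {x. integral_over A x}" "y \<in> {x. integral_over A x}"
  then obtain T where T: "integral_extension A T" "{x, y} \<subseteq> T"
    using integral_extension_finite[OF A, of "{x, y}"] by auto
  then show "x - y \<in> {x. integral_over A x}" "x * y \<in> {x. integral_over A x}"
    using subring_setD[OF integral_extension_subring[OF A T(1)]] integral_over_of_extension[OF A T(1)]
    by auto
qed

text \<open>The finitely many coefficients of \<open>p\<close> lie in one finite extension
  \<open>T\<close>. Adjoining \<open>x\<close> to \<open>T\<close> keeps the extension finite over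
  \<open>A\<close>.\<close>

lemma integral_over_trans:
  assumes A: "subring_set A" and p: "lead_coeff p = 1" "\<And>i. integral_over A (coeff p i)" "poly p x = 0"
  shows "integral_over A x"
proof -
  have "coeff p i \<in> insert 0 (coeff p ` {..degree p})" for i
    by (cases "i \<le> degree p") (auto simp: coeff_eq_0)
  then obtain T where T: "integral_extension A T" "\<And>i. coeff p i \<in> T"
    using integral_extension_finite[OF A, of "range (coeff p)"] p(2) 
    by (metis (no_types, lifting) finite_atMost finite_imageI finite_insert finite_subset image_subset_iff
        rangeE rangeI subsetD subsetI)
  then have "integral_over T x" using p by (auto simp: integral_over_def)
  with integral_extension_adjoin[OF A T(1)] integral_over_of_extension[OF A] show ?thesis by blast
qed

section \<open>Algebraic integers as elements integral over the integers\<close>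

lemma subring_set_Ints: "subring_set (\<int> :: 'a::idom set)"
  by (auto simp: subring_set_def)

lemma algebraic_int_iff_integral_over: "algebraic_int x \<longleftrightarrow> integral_over \<int> x"
  by (auto simp: integral_over_def algebraic_int.simps)

lemma subring_set_algebraic_int: "subring_set {x :: 'a::field. algebraic_int x}"
  using subring_set_integral_closure[OF subring_set_Ints]
  by (simp add: algebraic_int_iff_integral_over)

lemma algebraic_int_trans:
  fixes p :: "'a::field poly"
  assumes "lead_coeff p = 1" "\<And>i. algebraic_int (coeff p i)" "poly p x = 0"
  shows "algebraic_int x"
  using integral_over_trans[OF subring_set_Ints assms(1) _ assms(3)] assms(2)
  by (simp add: algebraic_int_iff_integral_over)

section \<open>Dedekind's Prague theorem\<close>

definition algebraic_int_poly :: "'a::field poly \<Rightarrow> bool"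
  where "algebraic_int_poly p \<longleftrightarrow> (\<forall>i. algebraic_int (coeff p i))"

lemma subring_set_algebraic_int_poly: "subring_set {p :: 'a::field poly. algebraic_int_poly p}"
  using subring_set_polys[OF subring_set_algebraic_int] by (simp add: algebraic_int_poly_def)

lemmas algebraic_int_closed = subring_setD[OF subring_set_algebraic_int, unfolded mem_Collect_eq]
lemmas algebraic_int_poly_closed =
  subring_setD[OF subring_set_algebraic_int_poly, unfolded mem_Collect_eq]

text \<open>Multiplying the equation \<open>p(r) = 0\<close> by \<open>c ^ (n - 1)\<close>, with
  \<open>c\<close> the leading coefficient, turns it into a monic equation for
  \<open>c * r\<close>.\<close>

lemma algebraic_int_lead_coeff_times_root:
  fixes p :: "'a::field poly"
  assumes p: "algebraic_int_poly p" "poly p r = 0"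
  shows "algebraic_int (lead_coeff p * r)"
proof (cases "p = 0")
  case False
  define n where "n = degree p"
  define c where "c = lead_coeff p"
  have "n > 0"
    using False p(2) by (auto simp: n_def elim!: degree_eq_zeroE intro!: Nat.gr0I)
  \<comment> \<open>The coefficients are chosen so that \<open>q(c x) = c ^ (n - 1) p(x)\<close> and
    \<open>q\<close> is monic of degree \<open>n\<close>.\<close>
  define q where "q = (\<Sum>i<n. monom (coeff p i * c ^ (n - 1 - i)) i) + monom 1 n"
  have coeff_q: "coeff q i = (if i < n then coeff p i * c ^ (n - 1 - i) else if i = n then 1 else 0)" for i
    by (auto simp: q_def coeff_sum coeff_monom)
  then have "degree q = n"
    by (intro antisym degree_le le_degree) auto
  then have "lead_coeff q = 1" by (simp add: coeff_q)
  moreover have "algebraic_int (coeff q i)" for i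
  proof -
    have "algebraic_int c" using p(1) unfolding c_def algebraic_int_poly_def by blast
    then have "algebraic_int (c ^ m)" for m
      using subring_set_power[OF subring_set_algebraic_int] by simp
    then show ?thesis using p(1) by (auto simp: coeff_q algebraic_int_poly_def algebraic_int_closed)
  qed
  moreover have "poly q (c * r) = 0"
  proof -
    have "poly q (c * r) = (\<Sum>i<n. coeff p i * c ^ (n - 1 - i) * (c * r) ^ i) + (c * r) ^ n"
      by (simp add: q_def poly_sum poly_monom)
    also have "(\<Sum>i<n. coeff p i * c ^ (n - 1 - i) * (c * r) ^ i) = (\<Sum>i<n. c ^ (n - 1) * (coeff p i * r ^ i))"
    proof (intro sum.cong refl)
      fix i assume "i \<in> {..<n}"
      then have "c ^ (n - 1) = c ^ (n - 1 - i) * c ^ i" by (simp flip: power_add)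
      then show "coeff p i * c ^ (n - 1 - i) * (c * r) ^ i = c ^ (n - 1) * (coeff p i * r ^ i)"
        by (simp add: power_mult_distrib)
    qed
    also have "(c * r) ^ n = c ^ (n - 1) * (coeff p n * r ^ n)"
      using \<open>n > 0\<close> by (cases n) (auto simp: c_def n_def power_mult_distrib)
    also have "(\<Sum>i<n. c ^ (n - 1) * (coeff p i * r ^ i)) + c ^ (n - 1) * (coeff p n * r ^ n)
        = c ^ (n - 1) * poly p r"
      by (simp add: poly_altdef n_def[symmetric] lessThan_Suc_atMost[symmetric]
          sum_distrib_left distrib_left)
    finally show ?thesis using p(2) by simp
  qed
  ultimately show ?thesis unfolding c_def by (rule algebraic_int_trans)
qed simp

text \<open>The quotient loses its leading term \<open>c x^n\<close> at each induction step. The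
  product then changes by \<open>c x^(n+1) - c r x^n\<close>, which is integral: \<open>c\<close> is
  also the leading coefficient of the product, of which \<open>r\<close> is a root, so the preceding
  lemma covers \<open>c * r\<close>.\<close>

lemma algebraic_int_poly_divide_root:
  fixes q :: "'a::field poly"
  assumes "algebraic_int_poly ([:-r, 1:] * q)"
  shows "algebraic_int_poly q"
  using assms
proof (induction "degree q" arbitrary: q rule: less_induct)
  case less
  show ?case
  proof (cases "q = 0")
    case True
    then show ?thesis by (simp add: algebraic_int_poly_closed)
  next
    case False
    define c where "c = lead_coeff q"
    define n where "n = degree q"
    define q' where "q' = q - monom c n"
    have monom_int: "algebraic_int_poly (monom a i)" if "algebraic_int a" for a i
      using that by (auto simp: algebraic_int_poly_def)
    have c: "c = lead_coeff ([:-r, 1:] * q)" by (simp only: lead_coeff_mult) (simp add: c_def)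
    then have "algebraic_int c" using less.prems by (simp only: algebraic_int_poly_def)
    have "algebraic_int (c * r)"
      unfolding c by (rule algebraic_int_lead_coeff_times_root[OF less.prems]) simp
    have "[:-r, 1:] * q' = [:-r, 1:] * q - (monom c (Suc n) - monom (c * r) n)"
      by (simp add: q'_def algebra_simps monom_Suc smult_monom smult_diff_right
          add_monom)
    then have *: "algebraic_int_poly ([:-r, 1:] * q')"
      using less.prems \<open>algebraic_int c\<close> \<open>algebraic_int (c * r)\<close>
      by (simp only: algebraic_int_poly_closed monom_int)
    have "algebraic_int_poly q'"
    proof (cases "q' = 0")
      case True
      then show ?thesis by (simp add: algebraic_int_poly_closed)
    next
      case nz: False
      have "degree q' \<le> n" unfolding q'_def n_def by (intro degree_diff_le degree_monom_le) simp_all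
      moreover have "coeff q' n = 0" by (simp add: q'_def c_def n_def)
      ultimately have "degree q' < degree q"
        using nz unfolding n_def by (metis leading_coeff_0_iff le_neq_implies_less)
      from less.hyps[OF this *] show ?thesis .
    qed
    moreover have "q = q' + monom c n" by (simp add: q'_def)
    ultimately show ?thesis using monom_int[OF \<open>algebraic_int c\<close>] algebraic_int_poly_closed by metis
  qed
qed

text \<open>Dedekind's Prague theorem, by splitting off the linear factors of \<open>f\<close> one at a time.\<close>

lemma algebraic_int_poly_smult_coeff:
  fixes f g :: "complex poly"
  assumes "algebraic_int_poly (f * g)"
  shows "algebraic_int_poly (smult (coeff f i) g)"
  using assms
proof (induction "degree f" arbitrary: f g i)
  case 0
  then obtain a where "f = [:a:]" by (metis degree_eq_zeroE)
  then show ?case using 0 by (cases i) (auto simp: algebraic_int_poly_closed)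
next
  case (Suc n)
  then obtain r where "poly f r = 0"
    using fundamental_theorem_of_algebra[of f] by (auto simp: constant_degree)
  then obtain f' where f: "f = [:-r, 1:] * f'" by (metis dvd_def poly_eq_0_iff_dvd)
  then have "f' \<noteq> 0" using Suc(2) by auto
  then have "degree f = Suc (degree f')" unfolding f by (subst degree_mult_eq) auto
  then have deg: "n = degree f'" using Suc(2) by simp
  have prod: "algebraic_int_poly ([:-r, 1:] * (f' * g))" using Suc.prems by (simp only: f mult.assoc)
  then have f'g: "algebraic_int_poly (f' * g)" by (rule algebraic_int_poly_divide_root)
  \<comment> \<open>The identity \<open>r f' g = x f' g - (x - r) f' g\<close> shows that
    \<open>f'\<close> times \<open>r g\<close> is integral as well. The induction hypothesis is
    therefore available for \<open>g\<close> and for \<open>r g\<close>.\<close>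
  have "f' * smult r g = pCons 0 (f' * g) - [:-r, 1:] * (f' * g)" by simp
  moreover have "algebraic_int_poly (pCons 0 (f' * g))"
    using f'g by (auto simp: algebraic_int_poly_def coeff_pCons split: nat.split)
  ultimately have f'rg: "algebraic_int_poly (f' * smult r g)"
    using prod by (metis algebraic_int_poly_closed(4))
  have "algebraic_int_poly (smult (coeff (pCons 0 f') i) g)"
    using Suc(1)[OF deg f'g] by (cases i) (auto simp: algebraic_int_poly_closed)
  moreover have "algebraic_int_poly (smult (coeff f' i * r) g)"
    using Suc(1)[OF deg f'rg, of i] by (simp add: mult.commute)
  \<comment> \<open>The coefficient of \<open>(x - r) f'\<close> at \<open>i\<close> is that of
    \<open>x f'\<close> minus \<open>r\<close> times that of \<open>f'\<close>; the two instances of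
    the induction hypothesis cover one term each.\<close>
  moreover have "smult (coeff f i) g = smult (coeff (pCons 0 f') i) g - smult (coeff f' i * r) g"
    by (simp add: f smult_diff_left[symmetric] mult.commute)
  ultimately show ?case by (metis algebraic_int_poly_closed(4))
qed

section \<open>Integrality over polynomial rings\<close>

lemma integral_over_const_poly:
  assumes "integral_over A x"
  shows "integral_over {p. \<forall>i. coeff p i \<in> A} [:x:]"
proof -
  from assms obtain p where p: "lead_coeff p = 1" "\<forall>i. coeff p i \<in> A" "poly p x = 0"
    unfolding integral_over_def by blast
  \<comment> \<open>Reading each coefficient as a constant polynomial turns the equation of
    \<open>x\<close> into one for \<open>[:x:]\<close>.\<close>
  define P where "P = map_poly (\<lambda>c. [:c:]) p"
  have coeff_P: "coeff P i = [:coeff p i:]" for i by (simp add: P_def coeff_map_poly)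
  then have "degree P = degree p"
    using p(1) by (intro antisym degree_le le_degree) (auto simp: coeff_eq_0)
  then have "lead_coeff P = 1" using p(1) by (simp add: coeff_P)
  moreover have "0 \<in> A" using p(2) coeff_eq_0[of p "Suc (degree p)"] by (metis lessI)
  then have "\<forall>i. coeff P i \<in> {p. \<forall>i. coeff p i \<in> A}"
    using p(2) by (auto simp: coeff_P coeff_pCons split: nat.split)
  moreover have "poly (map_poly (\<lambda>c. [:c:]) q) [:x:] = [:poly q x:]" for q :: "'a poly"
    by (induction q) (auto simp: map_poly_pCons)
  then have "poly P [:x:] = 0" using p(3) by (simp add: P_def)
  ultimately show ?thesis unfolding integral_over_def by blast
qed

text \<open>By Horner's scheme \<open>f\<close> is built from constants and the indeterminate. Both
  are integral over the polynomials with coefficients in \<open>A\<close>, and integral elements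
  form a ring.\<close>

lemma integral_over_poly:
  assumes A: "subring_set A" and f: "\<And>i. integral_over A (coeff f i)"
  shows "integral_over {p. \<forall>i. coeff p i \<in> A} f"
proof -
  let ?P = "{p. \<forall>i. coeff p i \<in> A}"
  note closed = subring_setD[OF subring_set_integral_closure[OF subring_set_polys[OF A]], simplified]
  have X: "integral_over ?P [:0, 1:]"
    using subring_setD[OF subring_set_polys[OF A]] subring_setD[OF A]
    by (auto simp: integral_over_def coeff_pCons split: nat.split intro!: exI[of _ "[:- [:0, 1:], 1:]"])
  have "integral_over ?P f" if "\<forall>i. integral_over A (coeff f i)" for f
    using that
  proof (induction f)
    case 0
    show ?case by (rule closed)
  next
    case (pCons a f)
    have "integral_over A (coeff f i)" for i using spec[OF pCons.prems, of "Suc i"] by simp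
    moreover have "integral_over A a" using spec[OF pCons.prems, of 0] by simp
    ultimately have "integral_over ?P ([:a:] + [:0, 1:] * f)"
      using pCons.IH X by (intro closed(5,6) integral_over_const_poly) auto
    then show ?case by simp
  qed
  then show ?thesis using f by blast
qed

text \<open>In an equation for \<open>x\<close> with constant term \<open>a \<noteq> 0\<close>, the
  remaining terms show that \<open>a\<close> is \<open>x\<close> times an element of
  \<open>B\<close>. If the constant term vanishes, a factor \<open>x\<close> cancels and a shorter
  equation remains.\<close>

lemma integral_over_multiple:
  assumes B: "subring_set B" "A \<subseteq> B" "x \<in> B" and x: "integral_over A x" "x \<noteq> 0"
  shows "\<exists>y\<in>B. x * y \<in> A \<and> x * y \<noteq> 0"
proof -
  have "\<exists>y\<in>B. x * y \<in> A \<and> x * y \<noteq> 0" if "p \<noteq> 0" "\<forall>i. coeff p i \<in> A" "poly p x = 0" for p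
    using that
  proof (induction p)
    case (pCons a p)
    have coeffs: "\<forall>i. coeff p i \<in> A" and "a \<in> A"
      using pCons.prems(2) by (metis coeff_pCons_Suc, metis coeff_pCons_0)
    show ?case
    proof (cases "a = 0")
      case True
      then show ?thesis using pCons coeffs x(2) by simp
    next
      case False
      have "poly p x \<in> B"
        unfolding poly_altdef using coeffs B
        by (intro subring_set_sum subring_setD subring_set_power) auto
      then have "- poly p x \<in> B" by (rule subring_setD[OF B(1)])
      moreover have "x * - poly p x = a" using pCons.prems(3) by (simp add: add_eq_0_iff2)
      ultimately show ?thesis using False \<open>a \<in> A\<close> by metis
    qed
  qed simp
  moreover obtain p where "lead_coeff p = 1" "\<forall>i. coeff p i \<in> A" "poly p x = 0"
    using x(1) unfolding integral_over_def by blast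
  ultimately show ?thesis by (metis leading_coeff_0_iff zero_neq_one)
qed

section \<open>Generators of finitely generated groups of rationals\<close>

lemma Rats_gcd:
  fixes x y :: "'a::field_char_0"
  assumes "x \<in> \<rat>" "y \<in> \<rat>"
  shows "\<exists>g. \<exists>s\<in>\<int>. \<exists>t\<in>\<int>. \<exists>u\<in>\<int>. \<exists>v\<in>\<int>. x = s * g \<and> y = t * g \<and> g = u * x + v * y"
proof -
  obtain a b where x: "x = of_int a / of_int b" "b \<noteq> 0"
    using assms(1) by (metis Rats_cases' less_irrefl)
  obtain c d where y: "y = of_int c / of_int d" "d \<noteq> 0"
    using assms(2) by (metis Rats_cases' less_irrefl)
  \<comment> \<open>Over the common denominator \<open>b * d\<close> the two numerators are
    \<open>a * d\<close> and \<open>c * b\<close>; Bezout's identity for them yields the combination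
    for \<open>g\<close>.\<close>
  define h where "h = gcd (a * d) (c * b)"
  obtain u v where uv: "u * (a * d) + v * (c * b) = h" using bezout_int unfolding h_def by blast
  obtain s where s: "a * d = h * s" unfolding h_def by (meson dvd_def gcd_dvd1)
  obtain t where t: "c * b = h * t" unfolding h_def by (meson dvd_def gcd_dvd2)
  define g :: 'a where "g = of_int h / of_int (b * d)"
  have "x = of_int (a * d) / of_int (b * d)" "y = of_int (c * b) / of_int (b * d)"
    using x y by simp_all
  moreover have "of_int u * (of_int (a * d) / of_int (b * d)) + of_int v * (of_int (c * b) / of_int (b * d)) = g"
    unfolding g_def uv[symmetric] by (simp add: add_divide_distrib)
  ultimately have "x = of_int s * g \<and> y = of_int t * g \<and> g = of_int u * x + of_int v * y"
    unfolding s t by (simp add: g_def)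
  then show ?thesis using Ints_of_int by blast
qed

text \<open>For \<open>Q\<close> the coefficients of a rational polynomial, \<open>g\<close> is its
  content. Inserting \<open>0\<close> keeps the product nonempty when \<open>Q\<close> is
  empty.\<close>

lemma Rats_finite_gcd:
  fixes Q :: "'a::field_char_0 set"
  assumes "finite Q" "Q \<subseteq> \<rat>"
  shows "\<exists>g. g \<in> mprod \<int> (insert 0 Q) \<and> (\<forall>x\<in>Q. \<exists>s\<in>\<int>. x = s * g)"
  using assms
proof (induction Q rule: finite_induct)
  case empty
  show ?case using mprod.mult[of 0 \<int> 0 "{0::'a}"] by auto
next
  case (insert x Q)
  then obtain g where g: "g \<in> mprod \<int> (insert 0 Q)" "\<forall>x\<in>Q. \<exists>s\<in>\<int>. x = s * g" by auto
  have "mprod \<int> (insert 0 Q) \<subseteq> \<rat>"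
  proof (rule mprod_least)
    fix a b :: 'a assume "a \<in> \<int>" "b \<in> insert 0 Q"
    then show "a * b \<in> \<rat>" using insert.prems Ints_subset_Rats by (intro Rats_mult) auto
  qed (rule Rats_add)
  then have "x \<in> \<rat>" "g \<in> \<rat>" using insert.prems g(1) by auto
  from Rats_gcd[OF this] obtain h s t u v where h: "x = s * h" "g = t * h" "h = u * x + v * g"
    and "s \<in> \<int>" "t \<in> \<int>" "u \<in> \<int>" "v \<in> \<int>"
    by blast
  have "v * y \<in> mprod \<int> (insert 0 (insert x Q))" if "y \<in> mprod \<int> (insert 0 Q)" for y
    using that
  proof induction
    case (mult a b)
    then show ?case using mprod.mult[of "v * a" \<int> b "insert 0 (insert x Q)"] \<open>v \<in> \<int>\<close>
      by (auto simp: mult.assoc)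
  next
    case (add y z)
    then show ?case by (simp add: distrib_left mprod.add)
  qed
  then have "h \<in> mprod \<int> (insert 0 (insert x Q))"
    unfolding h(3) using g(1) \<open>u \<in> \<int>\<close> by (intro mprod.add mprod.mult[of u]) auto
  moreover have "\<exists>s\<in>\<int>. y = s * h" if "y \<in> insert x Q" for y
  proof (cases "y = x")
    case True
    then show ?thesis using h(1) \<open>s \<in> \<int>\<close> by blast
  next
    case False
    then have "y \<in> Q" using that by simp
    from bspec[OF g(2) this] obtain s' where s': "s' \<in> \<int>" "y = s' * g" ..
    show ?thesis
    proof
      show "y = s' * t * h" by (simp only: s'(2) h(2) mult.assoc)
      show "s' * t \<in> \<int>" using s'(1) \<open>t \<in> \<int>\<close> by (rule Ints_mult)
    qed
  qed
  ultimately show ?case by blast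
qed

section \<open>Invertible modules over the ring of integers\<close>

lemma complex_field_simps [simp]:
  "carrier complex_field = UNIV" "x \<otimes>\<^bsub>complex_field\<^esub> y = x * y" "\<one>\<^bsub>complex_field\<^esub> = 1"
  "\<zero>\<^bsub>complex_field\<^esub> = 0" "x \<oplus>\<^bsub>complex_field\<^esub> y = x + y"
  by (simp_all add: ring_of_type_algebra_def)

lemma complex_field_a_inv [simp]: "\<ominus>\<^bsub>complex_field\<^esub> x = - x"
proof -
  interpret field complex_field by (rule field_from_type_algebra)
  show ?thesis by (rule minus_equality) simp_all
qed

text \<open>Each line extension contributes one generator. The zero space is spanned by
  \<open>{0}\<close>, because \<open>mprod K {}\<close> would be empty.\<close>

lemma dimension_imp_finite_span:
  assumes K: "subring_set K" and E: "ring.dimension complex_field n K E"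
  shows "\<exists>S. finite S \<and> S \<noteq> {} \<and> E = mprod K S"
proof -
  interpret field complex_field by (rule field_from_type_algebra)
  from E K show ?thesis
  proof (induction rule: dimension.induct)
    case (zero_dim K)
    then have "mprod K {0} = {0}"
      using mprod_least[of K "{0}" "{0}"] zero_in_mprod[of K 0 "{0}"] by (auto simp: subring_setD)
    then show ?case by (intro exI[of _ "{0}"]) simp
  next
    case (Suc_dim v E n K)
    then obtain S where S: "finite S" "S \<noteq> {}" "E = mprod K S" by blast
    note K = subring_setD[OF Suc_dim.prems]
    have "0 \<in> E" using S(2) K(2) by (auto simp: S(3) intro: zero_in_mprod)
    have "line_extension K v E = mprod K (insert v S)"
    proof
      show "line_extension K v E \<subseteq> mprod K (insert v S)"
        using mprod_mono[of K K S "insert v S"]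
        by (auto simp: line_extension_def set_add_def' r_coset_def S(3) intro!: mprod.add mprod.mult)
      show "mprod K (insert v S) \<subseteq> line_extension K v E"
      proof (rule mprod_least)
        fix a b assume "a \<in> K" "b \<in> insert v S"
        then have "\<exists>c\<in>K. \<exists>e\<in>E. a * b = c * v + e"
          using \<open>0 \<in> E\<close> K(2) mprod.mult[of a K b S] by (cases "b = v") (force simp: S(3))+
        then show "a * b \<in> line_extension K v E"
          unfolding line_extension_def set_add_def' r_coset_def by auto
      next
        fix x y assume "x \<in> line_extension K v E" "y \<in> line_extension K v E"
        then obtain a e b f where *: "a \<in> K" "e \<in> E" "x = a * v + e" "b \<in> K" "f \<in> E" "y = b * v + f"
          unfolding line_extension_def set_add_def' r_coset_def by auto
        then have "x + y = (a + b) * v + (e + f)" "a + b \<in> K" "e + f \<in> E"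
          by (auto simp: algebra_simps S(3) K intro: mprod.add)
        then show "x + y \<in> line_extension K v E"
          unfolding line_extension_def set_add_def' r_coset_def by auto
      qed
    qed
    then show ?case using S(1) by (intro exI[of _ "insert v S"]) simp
  qed
qed

lemma subring_set_Rats: "subring_set (\<rat> :: 'a::field_char_0 set)"
  by (auto simp: subring_set_def)

section \<open>Elementary properties of a number field\<close>

locale complex_number_field =
  fixes k :: "complex set"
  assumes number_field: "number_field k"
begin

abbreviation "Zk \<equiv> integers_of k"

lemma subring_set_k: "subring_set k"
proof -
  interpret field complex_field by (rule field_from_type_algebra)
  have "subring k complex_field" using number_field subfieldE(1) by (auto simp: number_field_def)
  note r = subringE[OF this]
  have "x - y \<in> k" if "x \<in> k" "y \<in> k" for x y
    using r(7)[of x "- y"] r(5)[of y] that by simp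
  then show ?thesis using r(3,6) by (simp add: subring_set_def)
qed

lemmas k_closed = subring_setD[OF subring_set_k]

lemma inverse_in_k:
  assumes "x \<in> k" shows "inverse x \<in> k"
proof (cases "x = 0")
  case False
  interpret field complex_field by (rule field_from_type_algebra)
  have "subfield k complex_field" using number_field by (simp add: number_field_def)
  from subfield_m_inv[OF this, of x] assms False
  obtain y where "y \<in> k" "x * y = 1" by auto
  then show ?thesis by (metis inverse_unique)
qed (use assms in simp)

lemma divide_in_k: "x \<in> k \<Longrightarrow> y \<in> k \<Longrightarrow> x / y \<in> k"
  by (simp add: divide_inverse k_closed inverse_in_k)

lemma Rats_subset_k: "\<rat> \<subseteq> k"
proof -
  have nat: "of_nat n \<in> k" for n by (induction n) (auto simp: k_closed)
  have "of_int n \<in> k" for n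
    by (cases n rule: int_cases2) (auto simp: nat k_closed)
  then show ?thesis by (auto elim!: Rats_cases' intro!: divide_in_k)
qed

text \<open>The finite degree of \<open>k\<close> enters here: \<open>k\<close> is a finite module
  over \<open>\<rat>\<close> that multiplication by \<open>x\<close> preserves, so the determinant
  trick applies.\<close>

lemma integral_over_Rats:
  assumes "x \<in> k" shows "integral_over \<rat> x"
proof -
  interpret field complex_field by (rule field_from_type_algebra)
  obtain n where "dimension n \<rat> k"
    using number_field by (auto simp: number_field_def finite_dimension_def)
  then obtain S where S: "finite S" "k = mprod \<rat> S"
    using dimension_imp_finite_span[OF subring_set_Rats] by blast
  have "\<not> S \<subseteq> {0}"
  proof
    assume "S \<subseteq> {0}"
    then have "mprod \<rat> S \<subseteq> {0}" by (intro mprod_least) auto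
    then show False using k_closed(1) S by auto
  qed
  then obtain s0 where "s0 \<in> S" "s0 \<noteq> 0" by auto
  moreover have "x * s \<in> mprod \<rat> S" if "s \<in> S" for s
    using k_closed(6)[OF assms] mprod.mult[OF Rats_1 that] by (simp add: S)
  ultimately show ?thesis using integral_over_of_finite[OF subring_set_Rats S(1)] by blast
qed

end

text \<open>The bridge from the linear combinations in the definitions to the inductive product. For
  empty \<open>S\<close> the two differ: the left side is \<open>{0}\<close>, the right side is
  empty.\<close>

lemma lincomb_eq_mprod:
  assumes "0 \<in> A" "\<And>x y. x \<in> A \<Longrightarrow> y \<in> A \<Longrightarrow> x + y \<in> A" "S \<noteq> {}"
  shows "lincomb A (*) S = mprod A S"
proof
  obtain s where "s \<in> S" using assms(3) by blast
  then have "0 \<in> mprod A S" using assms(1) by (rule zero_in_mprod[rotated])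
  then show "lincomb A (*) S \<subseteq> mprod A S"
    by (auto simp: lincomb_def intro!: sum_in_mprod mprod.mult)
  show "mprod A S \<subseteq> lincomb A (*) S"
  proof
    fix x assume "x \<in> mprod A S"
    then have "\<exists>F. finite F \<and> F \<subseteq> S \<and> x \<in> mprod A F"
    proof induction
      case (mult a b)
      then show ?case by (intro exI[of _ "{b}"]) (auto intro: mprod.mult)
    next
      case (add x y)
      then obtain F G where "finite F" "F \<subseteq> S" "x \<in> mprod A F" "finite G" "G \<subseteq> S" "y \<in> mprod A G"
        by blast
      then show ?case
        using mprod_mono[of A A F "F \<union> G"] mprod_mono[of A A G "F \<union> G"]
        by (intro exI[of _ "F \<union> G"]) (auto intro: mprod.add)
    qed
    then obtain F where F: "finite F" "F \<subseteq> S" "x \<in> mprod A F" by blast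
    obtain c where "c ` F \<subseteq> A" "x = (\<Sum>s\<in>F. c s * s)"
      using mprod_finite_expansion[OF F(3,1) assms(1,2)] by blast
    then show "x \<in> lincomb A (*) S" using F by (force simp: lincomb_def)
  qed
qed

section \<open>Scaling and conjugating products\<close>

lemma mprod_elt_times_left: "mprod (c *o A) B = c *o mprod A B"
proof
  show "mprod (c *o A) B \<subseteq> c *o mprod A B"
  proof (rule mprod_least)
    fix a b assume "a \<in> c *o A" "b \<in> B"
    then show "a * b \<in> c *o mprod A B"
      by (auto simp: elt_set_times_def mult.assoc intro!: mprod.mult)
  next
    fix x y assume "x \<in> c *o mprod A B" "y \<in> c *o mprod A B"
    then show "x + y \<in> c *o mprod A B"
      by (auto simp: elt_set_times_def distrib_left[symmetric] intro!: mprod.add)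
  qed
  have "c * x \<in> mprod (c *o A) B" if "x \<in> mprod A B" for x
    using that
  proof induction
    case (mult a b)
    then have "c * a * b \<in> mprod (c *o A) B"
      by (intro mprod.mult) (auto simp: elt_set_times_def)
    then show ?case by (simp add: mult.assoc)
  next
    case (add x y)
    then show ?case by (simp add: distrib_left mprod.add)
  qed
  then show "c *o mprod A B \<subseteq> mprod (c *o A) B" by (auto simp: elt_set_times_def)
qed

lemma mprod_elt_times_right: "mprod A (c *o B) = c *o mprod A B"
  by (metis mprod_elt_times_left mprod_commute)

lemma cnj_mprod: "cnj ` mprod A B = mprod (cnj ` A) (cnj ` B)"
proof
  have "cnj x \<in> mprod (cnj ` A) (cnj ` B)" if "x \<in> mprod A B" for x
    using that by induction (auto intro: mprod.intros)
  then show "cnj ` mprod A B \<subseteq> mprod (cnj ` A) (cnj ` B)" by blast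
  show "mprod (cnj ` A) (cnj ` B) \<subseteq> cnj ` mprod A B"
  proof (rule mprod_least)
    fix a b assume "a \<in> cnj ` A" "b \<in> cnj ` B"
    then show "a * b \<in> cnj ` mprod A B"
      by (auto simp flip: complex_cnj_mult intro: mprod.mult)
  next
    fix x y assume "x \<in> cnj ` mprod A B" "y \<in> cnj ` mprod A B"
    then show "x + y \<in> cnj ` mprod A B"
      by (auto simp flip: complex_cnj_add intro: mprod.add)
  qed
qed

lemma cnj_elt_times: "cnj ` (c *o A) = cnj c *o (cnj ` A)"
  by (force simp: elt_set_times_def)

lemma elt_times_inverse: "c \<noteq> 0 \<Longrightarrow> c *o (inverse c *o A) = (A :: 'a::field set)"
  by (simp add: set_times_rearrange2)

lemma elt_times_inverse': "c \<noteq> 0 \<Longrightarrow> inverse c *o (c *o A) = (A :: 'a::field set)"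
  by (simp add: set_times_rearrange2)

context complex_number_field
begin

section \<open>Submodules of the field over its ring of integers\<close>

lemma subring_set_Zk: "subring_set Zk"
  using k_closed algebraic_int_closed by (auto simp: subring_set_def integers_of_def)

lemmas Zk_closed = subring_setD[OF subring_set_Zk]

lemma Zk_subset_k: "Zk \<subseteq> k"
  by (auto simp: integers_of_def)

definition Zk_module :: "complex set \<Rightarrow> bool"
  where "Zk_module M \<longleftrightarrow>
    M \<subseteq> k \<and> 0 \<in> M \<and> (\<forall>x\<in>M. \<forall>y\<in>M. x + y \<in> M) \<and> (\<forall>a\<in>Zk. \<forall>x\<in>M. a * x \<in> M)"

lemma Zk_moduleD:
  assumes "Zk_module M"
  shows "x \<in> M \<Longrightarrow> x \<in> k" "0 \<in> M" "x \<in> M \<Longrightarrow> y \<in> M \<Longrightarrow> x + y \<in> M"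
    "a \<in> Zk \<Longrightarrow> x \<in> M \<Longrightarrow> a * x \<in> M" "x \<in> M \<Longrightarrow> - x \<in> M"
  using assms Zk_closed(3)[OF Zk_closed(1)]
  unfolding Zk_module_def by (blast, blast, blast, blast, metis mult_minus1)

lemma Zk_module_Zk: "Zk_module Zk"
  using Zk_closed Zk_subset_k by (auto simp: Zk_module_def)

lemma Zk_module_mprod_gen:
  assumes "Zk_module M" "S \<subseteq> k" "S \<noteq> {}"
  shows "Zk_module (mprod M S)"
  unfolding Zk_module_def
proof (intro conjI ballI)
  note M = Zk_moduleD[OF assms(1)]
  show "mprod M S \<subseteq> k" using assms(2) by (intro mprod_least) (auto simp: M k_closed)
  show "0 \<in> mprod M S" using assms(3) M(2) by (auto intro: zero_in_mprod)
  fix a x assume "a \<in> Zk" "x \<in> mprod M S"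
  from this(2) show "a * x \<in> mprod M S"
  proof induction
    case (mult m s)
    then show ?case using mprod.mult[of "a * m" M s S] M(4)[OF \<open>a \<in> Zk\<close>] by (simp add: mult.assoc)
  next
    case (add x y)
    then show ?case by (simp add: distrib_left mprod.add)
  qed
qed (rule mprod.add)

lemma Zk_module_mprod: "Zk_module M \<Longrightarrow> Zk_module N \<Longrightarrow> Zk_module (mprod M N)"
  by (intro Zk_module_mprod_gen) (auto simp: Zk_module_def)

lemma mprod_Zk [simp]: "Zk_module M \<Longrightarrow> mprod Zk M = M"
  using Zk_closed(1) mprod.mult[of 1 Zk _ M]
  by (intro antisym mprod_least) (auto simp: Zk_moduleD)

lemma mprod_Zk_right [simp]: "Zk_module M \<Longrightarrow> mprod M Zk = M"
  using mprod_Zk mprod_commute by metis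

lemma Zk_module_elt_times:
  assumes "Zk_module M" "c \<in> k" shows "Zk_module (c *o M)"
  unfolding Zk_module_def elt_set_times_def
proof (intro conjI ballI; (elim CollectE bexE)?)
  note M = Zk_moduleD[OF assms(1)]
  show "{x. \<exists>b\<in>M. x = c * b} \<subseteq> k" using M(1) k_closed(6)[OF assms(2)] by auto
  show "0 \<in> {x. \<exists>b\<in>M. x = c * b}" using M(2) by force
  show "x + y \<in> {x. \<exists>b\<in>M. x = c * b}" if "a \<in> M" "b \<in> M" "x = c * a" "y = c * b" for x y a b
    using M(3)[OF that(1,2)] that by (auto simp: distrib_left[symmetric])
  show "a * x \<in> {x. \<exists>b\<in>M. x = c * b}" if "a \<in> Zk" "b \<in> M" "x = c * b" for a b x
    using M(4)[OF that(1,2)] that by (auto simp: mult.left_commute[of a])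
qed

text \<open>A polynomial \<open>f\<close> whose coefficients generate the module has a multiple \<open>f * b\<close> over \<open>\<rat>\<close> that
  is integral and primitive; by Dedekind's Prague theorem the coefficients of \<open>b\<close> then generate the
  inverse module.\<close>

lemma fin_gen_module_inverse:
  assumes S: "finite S" "S \<subseteq> k" "\<not> S \<subseteq> {0}"
  shows "\<exists>N. Zk_module N \<and> mprod (mprod Zk S) N = Zk"
proof -
  obtain xs where xs: "set xs = S" using finite_list[OF S(1)] by blast
  define f where "f = Poly xs"
  have coeff_f: "coeff f i \<in> insert 0 S" for i
    using xs by (auto simp: f_def nth_default_def)
  have S_coeff: "\<exists>i. coeff f i = s" if "s \<in> S" for s
    using that xs by (metis f_def coeff_Poly_eq in_set_conv_nth nth_default_nth)
  have "f \<noteq> 0" using S(3) S_coeff by (metis coeff_0 insertI1 subsetI singleton_iff)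
  have f_k: "coeff f i \<in> k" for i using coeff_f[of i] S(2) k_closed(2) by auto
  have "integral_over {p. \<forall>i. coeff p i \<in> \<rat>} f"
    using integral_over_poly[OF subring_set_Rats] integral_over_Rats f_k by blast
  \<comment> \<open>This is the multiple of \<open>f\<close> with rational coefficients, provided by
    integrality of \<open>f\<close> over the rational polynomials.\<close>
  then obtain g where g: "\<forall>i. coeff g i \<in> k" "\<forall>i. coeff (f * g) i \<in> \<rat>" "f * g \<noteq> 0"
    using integral_over_multiple[OF subring_set_polys[OF subring_set_k] _ _ _ \<open>f \<noteq> 0\<close>,
        of "{p. \<forall>i. coeff p i \<in> \<rat>}"] Rats_subset_k f_k by blast
  define C where "C = coeff (f * g) ` {..degree (f * g)}"
  have C: "coeff (f * g) i \<in> insert 0 C" for i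
    by (cases "i \<le> degree (f * g)") (auto simp: C_def coeff_eq_0)
  \<comment> \<open>\<open>q\<close> is the content of \<open>f * g\<close>. Dividing
    \<open>g\<close> by it makes the product integral and primitive.\<close>
  obtain q where q: "q \<in> mprod \<int> (insert 0 C)" "\<forall>x\<in>C. \<exists>s\<in>\<int>. x = s * q"
    using Rats_finite_gcd[of C] g(2) by (auto simp: C_def)
  have "q \<noteq> 0"
  proof
    assume "q = 0"
    then have "C \<subseteq> {0}" using q(2) by auto
    then have "coeff (f * g) i = 0" for i using C[of i] by auto
    then show False using g(3) by (simp add: poly_eq_iff)
  qed
  have "mprod \<int> (insert 0 C) \<subseteq> \<rat>"
    by (intro mprod_least)
      (use g(2) Ints_subset_Rats in \<open>auto simp: C_def intro!: Rats_mult Rats_add\<close>)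
  then have "inverse q \<in> k" using q(1) Rats_subset_k inverse_in_k by blast
  define b where "b = smult (inverse q) g"
  have b_k: "coeff b i \<in> k" for i using g(1) \<open>inverse q \<in> k\<close> by (simp add: b_def k_closed)
  have coeff_fb: "coeff (f * b) i = coeff (f * g) i / q" for i
    by (simp add: b_def field_simps)
  have "coeff (f * b) i \<in> \<int>" for i
    using C[of i] q(2) \<open>q \<noteq> 0\<close> by (auto simp: coeff_fb)
  then have "algebraic_int_poly (f * b)"
    by (auto simp: algebraic_int_poly_def intro: int_imp_algebraic_int)
  then have prod_int: "coeff f i * coeff b j \<in> Zk" for i j
    using algebraic_int_poly_smult_coeff[of f b i] k_closed(6)[OF f_k b_k]
    by (auto simp: algebraic_int_poly_def integers_of_def)
  define N where "N = mprod Zk (range (coeff b))"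
  have N: "Zk_module N" unfolding N_def
    using b_k by (intro Zk_module_mprod_gen Zk_module_Zk) auto
  have MN: "Zk_module (mprod (mprod Zk S) N)"
    using S by (intro Zk_module_mprod N Zk_module_mprod_gen Zk_module_Zk) auto
  have "mprod (mprod Zk S) N = mprod Zk (mprod S (range (coeff b)))"
    by (metis N_def mprod_assoc mprod_left_commute mprod_Zk Zk_module_Zk)
  also have "\<dots> \<subseteq> Zk"
  proof -
    have "mprod S (range (coeff b)) \<subseteq> Zk"
    proof (rule mprod_least)
      fix s t assume "s \<in> S" "t \<in> range (coeff b)"
      then show "s * t \<in> Zk" using S_coeff[of s] prod_int by auto
    qed (rule Zk_closed)
    then have "mprod Zk (mprod S (range (coeff b))) \<subseteq> mprod Zk Zk" by (intro mprod_mono) auto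
    then show ?thesis using Zk_module_Zk by simp
  qed
  finally have sub: "mprod (mprod Zk S) N \<subseteq> Zk" .
  have "coeff f i * coeff b j \<in> mprod (mprod Zk S) N" for i j
  proof (cases "coeff f i = 0")
    case True
    then show ?thesis using Zk_moduleD(2)[OF MN] by simp
  next
    case False
    then have "coeff f i \<in> S" using coeff_f[of i] by auto
    then show ?thesis
      using mprod.mult[of 1 Zk "coeff f i" S] mprod.mult[of 1 Zk "coeff b j" "range (coeff b)"]
      by (auto simp: N_def Zk_closed intro!: mprod.mult)
  qed
  then have coeff_in: "coeff (f * b) i \<in> mprod (mprod Zk S) N" for i
    unfolding coeff_mult by (intro sum_in_mprod Zk_moduleD(2)[OF MN])
  \<comment> \<open>The content \<open>q\<close> is an integer combination of the coefficients of
    \<open>f * g\<close>. Dividing by \<open>q\<close> writes \<open>1\<close> as such a combination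
    of the coefficients of \<open>f * b\<close>, so \<open>1\<close> lies in the product
    module.\<close>
  have "x / q \<in> mprod (mprod Zk S) N" if "x \<in> mprod \<int> (insert 0 C)" for x
    using that
  proof induction
    case (mult a c)
    have "a \<in> Zk" using mult(1) Rats_subset_k Ints_subset_Rats
      by (auto simp: integers_of_def intro: int_imp_algebraic_int)
    moreover have "c / q \<in> mprod (mprod Zk S) N"
      using mult(2) coeff_in Zk_moduleD(2)[OF MN] by (auto simp: C_def coeff_fb)
    ultimately show ?case using Zk_moduleD(4)[OF MN, of a "c / q"] by simp
  next
    case (add x y)
    then show ?case by (simp add: add_divide_distrib mprod.add)
  qed
  from this[OF q(1)] have one: "1 \<in> mprod (mprod Zk S) N" using \<open>q \<noteq> 0\<close> by simp
  have "Zk \<subseteq> mprod (mprod Zk S) N"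
    using Zk_moduleD(4)[OF MN _ one] by auto
  with sub N show ?thesis by blast
qed

definition invertible :: "complex set \<Rightarrow> bool"
  where "invertible M \<longleftrightarrow> Zk_module M \<and> (\<exists>N. Zk_module N \<and> mprod M N = Zk)"

text \<open>If \<open>x\<close> multiplies \<open>M\<close> into \<open>Zk\<close>, then it
  multiplies \<open>mprod M N\<close> into \<open>N\<close>; applied to
  \<open>1 \<in> mprod M N\<close> this gives \<open>x \<in> N\<close>.\<close>

lemma frac_inverse_eqI:
  assumes M: "Zk_module M" and N: "Zk_module N" and MN: "mprod M N = Zk"
  shows "frac_inverse k M = N"
proof
  have "x * a \<in> Zk" if "x \<in> N" "a \<in> M" for x a
    using mprod.mult[OF that(2,1)] MN by (simp add: mult.commute)
  then show "N \<subseteq> frac_inverse k M"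
    using Zk_moduleD(1)[OF N] by (auto simp: frac_inverse_def)
  show "frac_inverse k M \<subseteq> N"
  proof
    fix x assume x: "x \<in> frac_inverse k M"
    have "x * y \<in> N" if "y \<in> mprod M N" for y
      using that
    proof induction
      case (mult a b)
      then have "x * a \<in> Zk" using x by (simp add: frac_inverse_def)
      then show ?case using Zk_moduleD(4)[OF N, of "x * a" b] mult by (simp add: mult.assoc)
    next
      case (add y z)
      then show ?case by (simp add: distrib_left Zk_moduleD(3)[OF N])
    qed
    from this[of 1] show "x \<in> N" using Zk_closed(1) by (simp add: MN)
  qed
qed

lemma invertible_inverse:
  assumes "invertible M"
  shows "Zk_module (frac_inverse k M)" "mprod M (frac_inverse k M) = Zk"
  using assms frac_inverse_eqI unfolding invertible_def by metis+

lemma invertible_frac_inverse: "invertible M \<Longrightarrow> invertible (frac_inverse k M)"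
  using invertible_inverse mprod_commute unfolding invertible_def by metis

lemma invertible_ne: "invertible M \<Longrightarrow> \<exists>x\<in>M. x \<noteq> 0"
proof (rule ccontr)
  assume "invertible M" "\<not> (\<exists>x\<in>M. x \<noteq> 0)"
  then have "mprod M (frac_inverse k M) \<subseteq> {0}" by (intro mprod_least) auto
  then show False using invertible_inverse(2)[OF \<open>invertible M\<close>] Zk_closed(1) by auto
qed

lemma invertible_cancel:
  assumes "invertible M" "Zk_module A" "Zk_module B" "mprod M A = mprod M B"
  shows "A = B"
  by (metis assms invertible_inverse(2) mprod_Zk mprod_assoc mprod_commute)

lemma fg_submodule_eq:
  assumes "S \<noteq> {}" shows "lincomb Zk (*) S = mprod Zk S"
  using assms by (intro lincomb_eq_mprod) (auto simp: Zk_closed)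

lemma lincomb_module: "Zk_module A \<Longrightarrow> S \<noteq> {} \<Longrightarrow> lincomb A (*) S = mprod A S"
  by (intro lincomb_eq_mprod) (auto simp: Zk_moduleD)

lemma fg_imp_Zk_module:
  assumes "fg_submodule Zk (*) k M" shows "Zk_module M"
proof -
  obtain S where S: "S \<subseteq> k" "M = lincomb Zk (*) S" using assms by (auto simp: fg_submodule_def)
  show ?thesis
  proof (cases "S = {}")
    case True
    then have "M = {0}" by (simp add: S lincomb_def)
    then show ?thesis using k_closed(2) by (simp add: Zk_module_def)
  next
    case False
    then show ?thesis using S fg_submodule_eq Zk_module_mprod_gen[OF Zk_module_Zk] by simp
  qed
qed

lemma fg_imp_invertible:
  assumes "fg_submodule Zk (*) k M" "M \<noteq> {0}"
  shows "invertible M"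
proof -
  obtain S where S: "finite S" "S \<subseteq> k" "M = lincomb Zk (*) S"
    using assms by (auto simp: fg_submodule_def)
  have "S \<noteq> {}" using assms(2) S(3) by (auto simp: lincomb_def)
  then have M: "M = mprod Zk S" using fg_submodule_eq S by simp
  have "\<not> S \<subseteq> {0}"
  proof
    assume "S \<subseteq> {0}"
    then have "M \<subseteq> {0}" unfolding M by (intro mprod_least) auto
    then show False using assms(2) Zk_moduleD(2)[OF fg_imp_Zk_module[OF assms(1)]] by auto
  qed
  with fin_gen_module_inverse[OF S(1,2)] fg_imp_Zk_module[OF assms(1)]
  show ?thesis by (auto simp: invertible_def M)
qed

text \<open>The expression of \<open>1\<close> as an element of \<open>M\<close> times its inverse
  involves only finitely many elements of \<open>M\<close>. Multiplying it by any
  \<open>x \<in> M\<close> expresses \<open>x\<close> through these with coefficients in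
  \<open>Zk\<close>, so they generate \<open>M\<close>.\<close>

lemma invertible_imp_fg:
  assumes "invertible M" shows "fg_submodule Zk (*) k M"
proof -
  note M = invertible_inverse[OF assms] Zk_moduleD[OF conjunct1[OF assms[unfolded invertible_def]]]
  have "x \<in> mprod M (frac_inverse k M) \<Longrightarrow> \<exists>F. finite F \<and> F \<subseteq> M \<and> x \<in> mprod F (frac_inverse k M)" for x
  proof (induction rule: mprod.induct)
    case (mult a b)
    then show ?case by (intro exI[of _ "{a}"]) (auto intro: mprod.mult)
  next
    case (add x y)
    then obtain F G where "finite F" "F \<subseteq> M" "x \<in> mprod F (frac_inverse k M)"
      "finite G" "G \<subseteq> M" "y \<in> mprod G (frac_inverse k M)" by blast
    then show ?case
      using mprod_mono[of F "F \<union> G", OF _ subset_refl, of "frac_inverse k M"]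
        mprod_mono[of G "F \<union> G", OF _ subset_refl, of "frac_inverse k M"]
      by (intro exI[of _ "F \<union> G"]) (auto intro!: mprod.add)
  qed
  from this[of 1] obtain F where F: "finite F" "F \<subseteq> M" "1 \<in> mprod F (frac_inverse k M)"
    using M(2) Zk_closed(1) by auto
  have "x * y \<in> mprod Zk F" if "y \<in> mprod F (frac_inverse k M)" "x \<in> M" for x y
    using that(1)
  proof induction
    case (mult a b)
    then have "x * b \<in> Zk" using that(2) M(2) mprod.mult by blast
    then show ?case using mprod.mult[of "x * b" Zk a F] mult by (simp add: mult_ac)
  next
    case (add x y)
    then show ?case by (simp add: distrib_left mprod.add)
  qed
  from this[OF F(3)] have "M \<subseteq> mprod Zk F" by auto
  moreover have "mprod Zk F \<subseteq> M" using F(2) by (intro mprod_least) (auto simp: M(3-7))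
  moreover have "F \<noteq> {}" using F(3) mprod_least[of "{}" "frac_inverse k M" "{}"] by auto
  ultimately have "M = lincomb Zk (*) F" using fg_submodule_eq by simp
  then show ?thesis unfolding fg_submodule_def using F(1,2) M(3) by blast
qed

lemma fractional_ideal_iff_invertible: "fractional_ideal k M \<longleftrightarrow> invertible M"
  using fg_imp_invertible invertible_imp_fg invertible_ne
  by (auto simp: fractional_ideal_def)

section \<open>Sums of modules and distributivity\<close>

lemma mprod_plus_right:
  assumes "Zk_module A" "Zk_module B" "Zk_module C"
  shows "mprod A (B + C) = mprod A B + mprod A C"
proof
  note AB = Zk_moduleD[OF Zk_module_mprod[OF assms(1,2)]]
  note AC = Zk_moduleD[OF Zk_module_mprod[OF assms(1,3)]]
  show "mprod A (B + C) \<subseteq> mprod A B + mprod A C"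
  proof (rule mprod_least)
    fix a x assume "a \<in> A" "x \<in> B + C"
    then show "a * x \<in> mprod A B + mprod A C"
      by (auto elim!: set_plus_elim simp: distrib_left intro!: set_plus_intro mprod.mult)
  next
    fix x y assume "x \<in> mprod A B + mprod A C" "y \<in> mprod A B + mprod A C"
    then obtain b c b' c' where "x = b + c" "y = b' + c'"
      "b \<in> mprod A B" "b' \<in> mprod A B" "c \<in> mprod A C" "c' \<in> mprod A C"
      by (auto elim!: set_plus_elim)
    moreover have "b + c + (b' + c') = (b + b') + (c + c')" by simp
    ultimately show "x + y \<in> mprod A B + mprod A C" using AB(3) AC(3) by (metis set_plus_intro)
  qed
  have BC: "B \<subseteq> B + C" "C \<subseteq> B + C"
    using Zk_moduleD(2)[OF assms(2)] Zk_moduleD(2)[OF assms(3)] set_plus_intro[of _ B 0 C]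
      set_plus_intro[of 0 B _ C] by auto
  have "mprod A B \<subseteq> mprod A (B + C)" "mprod A C \<subseteq> mprod A (B + C)"
    by (rule mprod_mono[OF subset_refl BC(1)], rule mprod_mono[OF subset_refl BC(2)])
  then show "mprod A B + mprod A C \<subseteq> mprod A (B + C)"
    by (auto elim!: set_plus_elim intro!: mprod.add)
qed

lemma Zk_module_plus:
  assumes "Zk_module A" "Zk_module B"
  shows "Zk_module (A + B)"
  unfolding Zk_module_def
proof (intro conjI ballI)
  note A = Zk_moduleD[OF assms(1)] and B = Zk_moduleD[OF assms(2)]
  show "A + B \<subseteq> k" using A(1) B(1) by (auto elim!: set_plus_elim intro: k_closed)
  show "0 \<in> A + B" using set_plus_intro[OF A(2) B(2)] by simp
  show "x + y \<in> A + B" if xy: "x \<in> A + B" "y \<in> A + B" for x y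
  proof -
    obtain a b a' b' where "x = a + b" "y = a' + b'" "a \<in> A" "b \<in> B" "a' \<in> A" "b' \<in> B"
      using xy by (elim set_plus_elim) blast
    moreover have "a + b + (a' + b') = (a + a') + (b + b')" by simp
    ultimately show ?thesis using A(3) B(3) by (metis set_plus_intro)
  qed
  show "c * x \<in> A + B" if "c \<in> Zk" "x \<in> A + B" for c x
    using that A(4) B(4) by (auto elim!: set_plus_elim simp: distrib_left intro!: set_plus_intro)
qed

lemma Zk_module_zero: "Zk_module {0}"
  by (auto simp: Zk_module_def k_closed)

lemma Zk_module_sum:
  assumes "\<And>i. i \<in> F \<Longrightarrow> Zk_module (f i)"
  shows "Zk_module (sum f F)"
  using assms
  by (induction F rule: infinite_finite_induct) (auto simp: Zk_module_zero intro: Zk_module_plus)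

text \<open>Distributivity is iterated over \<open>F\<close>. The empty sum of sets is
  \<open>{0}\<close>, which multiplication by \<open>A\<close> preserves.\<close>

lemma mprod_sum_right:
  assumes "Zk_module A" "\<And>i. i \<in> F \<Longrightarrow> Zk_module (f i)"
  shows "mprod A (\<Sum>i\<in>F. f i) = (\<Sum>i\<in>F. mprod A (f i))"
proof -
  have zero: "mprod A {0} = {0}"
    using mprod_least[of A "{0}" "{0}"] Zk_moduleD(2)[OF Zk_module_mprod[OF assms(1) Zk_module_zero]]
    by auto
  show ?thesis
    using assms
    by (induction F rule: infinite_finite_induct)
       (auto simp: zero mprod_plus_right Zk_module_sum)
qed

lemma Zk_module_le_sum:
  assumes "finite F" "i \<in> F" "\<And>i. i \<in> F \<Longrightarrow> Zk_module (f i)"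
  shows "f i \<subseteq> sum f F"
proof -
  have "0 \<in> sum f (F - {i})" using assms by (intro Zk_moduleD Zk_module_sum) auto
  moreover have "sum f F = f i + sum f (F - {i})" using assms(1,2) by (rule sum.remove)
  ultimately show ?thesis using set_plus_intro[of _ "f i" 0] by auto
qed

lemma Zk_module_sum_least:
  assumes "\<And>i. i \<in> F \<Longrightarrow> f i \<subseteq> M" "Zk_module M"
  shows "sum f F \<subseteq> M"
  using assms(1)
proof (induction F rule: infinite_finite_induct)
  case (insert i F)
  then have "f i \<subseteq> M" "sum f F \<subseteq> M" by auto
  then have "f i + sum f F \<subseteq> M"
    using Zk_moduleD(3)[OF assms(2)] by (auto elim!: set_plus_elim)
  then show ?case using insert.hyps by simp
qed (auto simp: Zk_moduleD(2)[OF assms(2)])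

lemma invertible_module: "invertible M \<Longrightarrow> Zk_module M"
  by (simp add: invertible_def)

text \<open>The union of finite generating sets of \<open>A\<close> and \<open>B\<close> generates
  \<open>A + B\<close>, and nonzero finitely generated modules are invertible.\<close>

lemma invertible_plus:
  assumes "invertible A" "invertible B"
  shows "invertible (A + B)"
proof -
  have gen: "\<exists>S. finite S \<and> S \<subseteq> k \<and> S \<noteq> {} \<and> M = mprod Zk S" if M: "invertible M" for M
  proof -
    obtain S where S: "finite S" "S \<subseteq> k" "M = lincomb Zk (*) S"
      using invertible_imp_fg[OF M] by (auto simp: fg_submodule_def)
    moreover have "S \<noteq> {}" using invertible_ne[OF M] S(3) by (auto simp: lincomb_def)
    ultimately show ?thesis using fg_submodule_eq by blast
  qed
  obtain S T where S: "finite S" "S \<subseteq> k" "S \<noteq> {}" "A = mprod Zk S"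
    and T: "finite T" "T \<subseteq> k" "T \<noteq> {}" "B = mprod Zk T"
    using gen[OF assms(1)] gen[OF assms(2)] by blast
  note A = Zk_moduleD[OF invertible_module[OF assms(1)]]
    and B = Zk_moduleD[OF invertible_module[OF assms(2)]]
  have "mprod Zk S \<subseteq> mprod Zk (S \<union> T)" "mprod Zk T \<subseteq> mprod Zk (S \<union> T)"
    by (rule mprod_mono[OF subset_refl Un_upper1], rule mprod_mono[OF subset_refl Un_upper2])
  then have "A + B \<subseteq> mprod Zk (S \<union> T)"
    unfolding S T by (auto elim!: set_plus_elim intro!: mprod.add)
  moreover have "mprod Zk (S \<union> T) \<subseteq> A + B"
  proof (rule mprod_least)
    fix a s assume "a \<in> Zk" "s \<in> S \<union> T"
    then show "a * s \<in> A + B"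
      using mprod.mult[of a Zk s] set_plus_intro[OF _ B(2), of "a * s"] set_plus_intro[OF A(2), of "a * s"]
      by (auto simp: S T)
  next
    fix x y assume "x \<in> A + B" "y \<in> A + B"
    then show "x + y \<in> A + B"
      using Zk_moduleD(3)[OF Zk_module_plus] assms invertible_module by blast
  qed
  ultimately have "A + B = lincomb Zk (*) (S \<union> T)"
    using fg_submodule_eq[of "S \<union> T"] S(3) by auto
  then have "fg_submodule Zk (*) k (A + B)"
    unfolding fg_submodule_def using S T by (intro exI[of _ "S \<union> T"]) auto
  moreover have "A + B \<noteq> {0}"
    using invertible_ne[OF assms(1)] set_plus_intro[OF _ B(2), of _ A] by auto
  ultimately show ?thesis by (rule fg_imp_invertible)
qed

lemma invertible_sum:
  assumes "finite F" "F \<noteq> {}" "\<And>i. i \<in> F \<Longrightarrow> invertible (f i)"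
  shows "invertible (sum f F)"
  using assms by (induction rule: finite_ne_induct) (auto intro: invertible_plus)

lemma invertible_elt_times:
  assumes "invertible M" "c \<in> k" "c \<noteq> 0"
  shows "invertible (c *o M)"
proof -
  \<comment> \<open>The inverse module is scaled by the inverse factor.\<close>
  have "mprod (c *o M) (inverse c *o frac_inverse k M) = Zk"
    using assms by (simp add: mprod_elt_times_left mprod_elt_times_right elt_times_inverse
        elt_times_inverse' invertible_inverse(2))
  then show ?thesis
    using assms Zk_module_elt_times invertible_inverse(1) inverse_in_k
    unfolding invertible_def by blast
qed

section \<open>Ideals of the ring of integers as modules\<close>

lemma integer_ring_simps [simp]:
  "carrier (integer_ring k) = Zk" "x \<otimes>\<^bsub>integer_ring k\<^esub> y = x * y"
  "x \<oplus>\<^bsub>integer_ring k\<^esub> y = x + y" "\<zero>\<^bsub>integer_ring k\<^esub> = 0"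
  by (simp_all add: integer_ring_def)

lemma ring_integer_ring: "ring (integer_ring k)"
proof -
  interpret field complex_field by (rule field_from_type_algebra)
  have "subring Zk complex_field" by (rule subringI) (auto simp: Zk_closed)
  then show ?thesis unfolding integer_ring_def by (rule subring_is_ring)
qed

lemma ideal_integer_ring_iff: "ideal M (integer_ring k) \<longleftrightarrow> Zk_module M \<and> M \<subseteq> Zk"
proof
  interpret ring "integer_ring k" by (rule ring_integer_ring)
  {
    assume "ideal M (integer_ring k)"
    then interpret ideal M "integer_ring k" .
    have "M \<subseteq> Zk" using a_subset by simp
    moreover have "Zk_module M"
      unfolding Zk_module_def using \<open>M \<subseteq> Zk\<close> Zk_subset_k additive_subgroup.zero_closed
        additive_subgroup.a_closed I_l_closed zero_closed a_closed by auto
    ultimately show "Zk_module M \<and> M \<subseteq> Zk" by blast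
  }
  assume M: "Zk_module M \<and> M \<subseteq> Zk"
  have inv: "\<ominus>\<^bsub>integer_ring k\<^esub> x = - x" if "x \<in> Zk" for x
    using that Zk_closed(3) by (intro minus_equality) auto
  show "ideal M (integer_ring k)"
  proof (rule idealI[OF ring_integer_ring])
    show "subgroup M (add_monoid (integer_ring k))"
    proof (rule add.subgroupI)
      fix a assume "a \<in> M"
      then show "\<ominus>\<^bsub>integer_ring k\<^esub> a \<in> M" using M inv Zk_moduleD(5)[of M a] by auto
    qed (use M in \<open>auto simp: Zk_moduleD dest: Zk_moduleD(2)\<close>)
    fix a x assume "a \<in> M" "x \<in> carrier (integer_ring k)"
    then show "x \<otimes>\<^bsub>integer_ring k\<^esub> a \<in> M" "a \<otimes>\<^bsub>integer_ring k\<^esub> x \<in> M"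
      using M Zk_moduleD(4)[of M x a] by (simp_all add: mult.commute[of a x])
  qed
qed

lemma ideal_prod_eq_mprod: "A \<cdot>\<^bsub>integer_ring k\<^esub> B = mprod A B"
proof
  show "A \<cdot>\<^bsub>integer_ring k\<^esub> B \<subseteq> mprod A B"
  proof
    fix x assume "x \<in> A \<cdot>\<^bsub>integer_ring k\<^esub> B"
    then show "x \<in> mprod A B" by induction (auto intro: mprod.intros)
  qed
  show "mprod A B \<subseteq> A \<cdot>\<^bsub>integer_ring k\<^esub> B"
    using ideal_prod.intros[where R = "integer_ring k"] by (intro mprod_least) simp_all
qed

end

section \<open>Roots and reflections on a line\<close>

lemma standard_pair_simps [simp]:
  "base (standard_pair k) = k" "scaleV (standard_pair k) = (*)" "spaceV (standard_pair k) = k"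
  "scaleW (standard_pair k) = (*)" "spaceW (standard_pair k) = k"
  "pairing (standard_pair k) = (\<lambda>a b. a * cnj b)"
  by (simp_all add: standard_pair_def)

locale cyclotomic_number_field = complex_number_field +
  fixes d :: nat
  assumes d: "d \<ge> 2" and cnj_k: "cnj ` k \<subseteq> k" and roots_k: "roots_of_unity d \<subseteq> k"
begin

abbreviation "H \<equiv> standard_pair k"
abbreviation "mul z \<equiv> (\<lambda>x\<in>k. z * x)"

section \<open>Complex conjugation and the pairing on the line\<close>

lemma cnj_in_k: "x \<in> k \<Longrightarrow> cnj x \<in> k"
  using cnj_k by blast

lemma cnj_Zk [simp]: "cnj ` Zk = Zk"
proof -
  have "cnj x \<in> Zk" if "x \<in> Zk" for x using that by (auto simp: integers_of_def cnj_in_k)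
  then show ?thesis by (metis complex_cnj_cnj image_eqI subset_antisym image_subsetI subsetI)
qed

lemma cnj_image_cnj [simp]: "cnj ` cnj ` A = A"
  by (simp add: image_image)

lemma Zk_module_cnj: "Zk_module M \<Longrightarrow> Zk_module (cnj ` M)"
  unfolding Zk_module_def
proof (intro conjI ballI; (elim conjE imageE)?)
  assume M: "M \<subseteq> k" "0 \<in> M" "\<forall>x\<in>M. \<forall>y\<in>M. x + y \<in> M" "\<forall>a\<in>Zk. \<forall>x\<in>M. a * x \<in> M"
  show "cnj ` M \<subseteq> k" using M(1) cnj_in_k by blast
  show "0 \<in> cnj ` M" using M(2) by force
  show "x + y \<in> cnj ` M" if "a \<in> M" "b \<in> M" "x = cnj a" "y = cnj b" for x y a b
    using M(3) that by (metis complex_cnj_add image_eqI)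
  show "a * x \<in> cnj ` M" if "a \<in> Zk" "b \<in> M" "x = cnj b" for a x b
  proof -
    have "cnj a \<in> Zk" using that(1) cnj_Zk by blast
    then have "cnj (cnj a * b) \<in> cnj ` M" using M(4) that by blast
    then show ?thesis using that by simp
  qed
qed

lemma invertible_cnj:
  assumes "invertible M" shows "invertible (cnj ` M)"
proof -
  have "mprod (cnj ` M) (cnj ` frac_inverse k M) = Zk"
    using invertible_inverse(2)[OF assms] cnj_mprod[of M "frac_inverse k M"] by simp
  then show ?thesis
    using assms Zk_module_cnj invertible_inverse(1) unfolding invertible_def by blast
qed

lemma invertible_cnj_iff: "invertible (cnj ` M) \<longleftrightarrow> invertible M"
  using invertible_cnj[of M] invertible_cnj[of "cnj ` M"] by auto

text \<open>Coefficients from \<open>Zk\<close> are absorbed into \<open>I\<close>; \<open>J\<close>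
  enters conjugated because the pairing is semilinear in its second argument.\<close>

lemma pairing_ideal_eq:
  assumes "Zk_module I" "Zk_module J"
  shows "pairing_ideal H I J = mprod I (cnj ` J)"
proof -
  note I = Zk_moduleD[OF assms(1)]
  let ?P = "{\<alpha> * cnj \<beta> |\<alpha> \<beta>. \<alpha> \<in> I \<and> \<beta> \<in> J}"
  have "?P \<noteq> {}" using I(2) Zk_moduleD(2)[OF assms(2)] by blast
  then have "pairing_ideal H I J = mprod Zk ?P" by (simp add: pairing_ideal_def fg_submodule_eq)
  also have "\<dots> = mprod I (cnj ` J)"
  proof
    show "mprod Zk ?P \<subseteq> mprod I (cnj ` J)"
    proof (rule mprod_least)
      fix a x assume "a \<in> Zk" "x \<in> ?P"
      then obtain \<alpha> \<beta> where "x = \<alpha> * cnj \<beta>" "a * \<alpha> \<in> I" "\<beta> \<in> J" using I(4) by blast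
      then show "a * x \<in> mprod I (cnj ` J)"
        using mprod.mult[of "a * \<alpha>" I "cnj \<beta>" "cnj ` J"] by (simp add: mult.assoc)
    qed (rule mprod.add)
    have "\<alpha> * cnj \<beta> \<in> mprod Zk ?P" if "\<alpha> \<in> I" "\<beta> \<in> J" for \<alpha> \<beta>
      using mprod.mult[OF Zk_closed(1), of "\<alpha> * cnj \<beta>" ?P] that by auto
    then show "mprod I (cnj ` J) \<subseteq> mprod Zk ?P"
      by (intro mprod_least) (auto intro: mprod.add)
  qed
  finally show ?thesis .
qed

lemma lincomb_k:
  assumes "S \<subseteq> k" "s \<in> S" "s \<noteq> 0"
  shows "lincomb k (*) S = k"
proof -
  have "lincomb k (*) S = mprod k S"
    using assms(2) by (intro lincomb_eq_mprod) (auto simp: k_closed)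
  moreover have "mprod k S \<subseteq> k" using assms(1) by (intro mprod_least) (auto simp: k_closed)
  moreover have "x \<in> mprod k S" if "x \<in> k" for x
    using mprod.mult[OF divide_in_k[OF that] assms(2), of s] assms by auto
  ultimately show ?thesis by blast
qed

text \<open>In the one-dimensional space \<open>k\<close> any nonzero element spans everything, so
  rank one just means nonzero.\<close>

lemma invertible_iff_fg_rank_one:
  "invertible M \<longleftrightarrow> fg_submodule Zk (*) k M \<and> rank_one k (*) M"
proof
  assume M: "invertible M"
  have "lincomb k (*) M = k"
    using invertible_ne[OF M] Zk_moduleD(1)[OF invertible_module[OF M]] lincomb_k by blast
  then have "rank_one k (*) M" unfolding rank_one_def by (intro exI[of _ 1]) simp
  then show "fg_submodule Zk (*) k M \<and> rank_one k (*) M" using invertible_imp_fg[OF M] by simp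
next
  assume M: "fg_submodule Zk (*) k M \<and> rank_one k (*) M"
  have "M \<noteq> {0}"
  proof
    assume "M = {0}"
    moreover have "mprod k {0} \<subseteq> {0}" by (rule mprod_least) auto
    ultimately have "lincomb k (*) M \<subseteq> {0}"
      using lincomb_eq_mprod[of k "{0}"] k_closed by simp
    moreover obtain v where "v \<noteq> 0" "lincomb k (*) M = (\<lambda>c. c * v) ` k"
      using M unfolding rank_one_def by blast
    ultimately show False using k_closed(1) by force
  qed
  then show "invertible M" using M fg_imp_invertible by blast
qed

lemma is_root_iff:
  "is_root H (I, J, \<xi>) \<longleftrightarrow> invertible I \<and> invertible J \<and> \<xi> \<in> k \<and> \<xi> \<noteq> 1 \<and>
    (\<exists>n::nat. n > 0 \<and> \<xi> ^ n = 1) \<and> mprod I (cnj ` J) = (1 - \<xi>) *o Zk"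
  using pairing_ideal_eq[of I J] invertible_module
  by (auto simp: is_root_def invertible_iff_fg_rank_one)

text \<open>The map \<open>x - x * cnj w * v\<close> depends on \<open>v\<close> and
  \<open>w\<close> only through \<open>v * cnj w = 1 - \<xi>\<close>, which makes the definite
  description unique. Since \<open>I\<close> and \<open>J\<close> both span \<open>k\<close>, the
  pair \<open>1 - \<xi>\<close> and \<open>1\<close> is an admissible choice.\<close>

lemma root_reflection_eq:
  assumes "is_root H (I, J, \<xi>)"
  shows "root_reflection H (I, J, \<xi>) = mul \<xi>"
proof -
  have r: "invertible I" "invertible J" "\<xi> \<in> k" using assms by (auto simp: is_root_iff)
  have I: "lincomb k (*) I = k" and J: "lincomb k (*) J = k"
    using invertible_ne[OF r(1)] Zk_moduleD(1)[OF invertible_module[OF r(1)]]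
      invertible_ne[OF r(2)] Zk_moduleD(1)[OF invertible_module[OF r(2)]] lincomb_k by blast+
  have eq: "(\<lambda>x\<in>k. x - x * cnj w * v) = mul \<xi>" if "v * cnj w = 1 - \<xi>" for v w
  proof -
    have "x - x * cnj w * v = \<xi> * x" for x
      using arg_cong[OF that, of "\<lambda>t. x - x * t"] by (simp add: algebra_simps)
    then show ?thesis by simp
  qed
  show ?thesis
    unfolding root_reflection_def prod.case
  proof (rule the_equality)
    show "\<exists>v\<in>lincomb (base H) (scaleV H) I. \<exists>w\<in>lincomb (base H) (scaleW H) J.
        pairing H v w = 1 - \<xi> \<and> mul \<xi> = (\<lambda>x\<in>spaceV H. x - scaleV H (pairing H x w) v)"
      using r(3) k_closed eq[of "1 - \<xi>" 1] by (simp add: I J) (intro bexI[of _ "1 - \<xi>"] bexI[of _ 1]; simp)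
  qed (use eq in auto)
qed

section \<open>Roots of unity\<close>

lemma zeta_power: "zeta d ^ j = cis (2 * pi * real j / real d)"
proof -
  have "zeta d = cis (2 * pi / real d)"
    by (simp add: zeta_def cis_conv_exp mult_ac)
  then show ?thesis by (simp add: DeMoivre mult_ac)
qed

lemma bij_betw_zeta: "bij_betw (\<lambda>j. zeta d ^ j) {..<d} (roots_of_unity d)"
  using bij_betw_roots_unity[of d] d by (simp add: zeta_power roots_of_unity_def)

lemma zeta_inj: "i \<in> {1..d - 1} \<Longrightarrow> j \<in> {1..d - 1} \<Longrightarrow> zeta d ^ i = zeta d ^ j \<longleftrightarrow> i = j"
  using bij_betw_imp_inj_on[OF bij_betw_zeta] by (auto simp: inj_on_def)

lemma zeta_root: "zeta d ^ j \<in> roots_of_unity d"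
proof -
  have "zeta d ^ (j mod d) \<in> roots_of_unity d"
    using bij_betw_apply[OF bij_betw_zeta, of "j mod d"] d by simp
  moreover have "zeta d ^ d = 1" using d by (simp add: zeta_power)
  then have "zeta d ^ j = zeta d ^ (j mod d)"
    by (metis mult_div_mod_eq power_add power_mult power_one mult_1)
  ultimately show ?thesis by simp
qed

lemma zeta_ne_1: "j \<in> {1..d - 1} \<Longrightarrow> zeta d ^ j \<noteq> 1"
proof
  assume j: "j \<in> {1..d - 1}" "zeta d ^ j = 1"
  have "j = 0"
    by (rule inj_onD[OF bij_betw_imp_inj_on[OF bij_betw_zeta]]) (use j d in auto)
  then show False using j(1) by simp
qed

lemma roots_of_unity_minus_1: "roots_of_unity d - {1} = (\<lambda>j. zeta d ^ j) ` {1..d - 1}"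
proof
  show "roots_of_unity d - {1} \<subseteq> (\<lambda>j. zeta d ^ j) ` {1..d - 1}"
  proof
    fix z assume z: "z \<in> roots_of_unity d - {1}"
    then obtain j where "j < d" "z = zeta d ^ j"
      using bij_betw_imp_surj_on[OF bij_betw_zeta] by auto
    moreover have "j \<noteq> 0" using z calculation by (metis DiffD2 power_0 singletonI)
    ultimately show "z \<in> (\<lambda>j. zeta d ^ j) ` {1..d - 1}" by auto
  qed
qed (use zeta_root zeta_ne_1 in auto)

lemma root_of_unity:
  assumes "z \<in> roots_of_unity d"
  shows "z \<in> k" "z \<noteq> 0" "z \<in> Zk" "inverse z \<in> roots_of_unity d" "cnj z = inverse z"
proof -
  have z: "z ^ d = 1" using assms by (simp add: roots_of_unity_def)
  show k: "z \<in> k" using assms roots_k by blast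
  show nz: "z \<noteq> 0" using z d by (auto simp: power_0_left)
  show "inverse z \<in> roots_of_unity d" using z by (simp add: roots_of_unity_def power_inverse)
  \<comment> \<open>The monic integer polynomial \<open>x^d - 1\<close> witnesses that
    \<open>z\<close> is an algebraic integer.\<close>
  define p :: "complex poly" where "p = monom 1 d - 1"
  have "coeff p d = 1" using d by (simp add: p_def)
  moreover have "degree p \<le> d" unfolding p_def by (intro degree_diff_le degree_monom_le) simp
  ultimately have "degree p = d" by (intro antisym le_degree) auto
  with \<open>coeff p d = 1\<close> have "lead_coeff p = 1" by simp
  moreover have "\<forall>i. coeff p i \<in> \<int>" by (auto simp: p_def coeff_pCons split: nat.split)
  moreover have "poly p z = 0" using z by (simp add: p_def poly_monom)
  ultimately show "z \<in> Zk" using k by (auto simp: integers_of_def intro: algebraic_int.intros)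
  have "norm z ^ d = 1" using z by (metis norm_one norm_power)
  then have "norm z = 1" using d power_eq_1_iff[of "norm z" d] by auto
  then have "z * cnj z = 1" by (metis complex_norm_square of_real_1 power_one)
  then show "cnj z = inverse z" by (rule inverse_unique[symmetric])
qed

lemma roots_of_unity_closed:
  "1 \<in> roots_of_unity d" "z \<in> roots_of_unity d \<Longrightarrow> w \<in> roots_of_unity d \<Longrightarrow> z * w \<in> roots_of_unity d"
  by (auto simp: roots_of_unity_def power_mult_distrib)

text \<open>Both \<open>z\<close> and its inverse are algebraic integers, so multiplication by
  \<open>z\<close> maps \<open>M\<close> onto itself.\<close>

lemma mul_image:
  assumes "z \<in> roots_of_unity d" "Zk_module M"
  shows "mul z ` M = M"
proof -
  note M = Zk_moduleD[OF assms(2)]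
  have "mul z ` M = (*) z ` M" using M(1) by (intro image_cong) auto
  also have "\<dots> = M"
  proof
    show "(*) z ` M \<subseteq> M" using M(4) root_of_unity(3)[OF assms(1)] by blast
    show "M \<subseteq> (*) z ` M"
    proof
      fix x assume "x \<in> M"
      then have "inverse z * x \<in> M" using M(4) root_of_unity(3,4) assms(1) by blast
      then show "x \<in> (*) z ` M"
        using root_of_unity(2)[OF assms(1)] by (intro image_eqI[of _ _ "inverse z * x"]) auto
    qed
  qed
  finally show ?thesis .
qed

section \<open>Multiplications by roots of unity in the general linear group\<close>

lemma Zk_module_k: "Zk_module k"
  using k_closed Zk_subset_k by (auto simp: Zk_module_def)

lemma mul_in_Bij:
  assumes "z \<in> roots_of_unity d"
  shows "mul z \<in> Bij k"
proof -
  have "inj_on (mul z) k" using root_of_unity(2)[OF assms] by (auto simp: inj_on_def)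
  then show ?thesis using mul_image[OF assms Zk_module_k] by (simp add: Bij_def bij_betw_def)
qed

lemma GL_simps:
  "\<one>\<^bsub>GL k (*) k\<^esub> = mul 1"
  "f \<in> Bij k \<Longrightarrow> g \<in> Bij k \<Longrightarrow> f \<otimes>\<^bsub>GL k (*) k\<^esub> g = compose k f g"
  by (simp_all add: GL_def BijGroup_def)

lemma mul_in_GL: "z \<in> roots_of_unity d \<Longrightarrow> mul z \<in> carrier (GL k (*) k)"
  by (auto simp: GL_def mul_in_Bij distrib_left k_closed)

lemma mul_mult:
  assumes "z \<in> roots_of_unity d" "w \<in> roots_of_unity d"
  shows "mul z \<otimes>\<^bsub>GL k (*) k\<^esub> mul w = mul (z * w)"
  using assms
  by (auto simp: GL_simps mul_in_Bij compose_def k_closed root_of_unity mult.assoc intro!: restrict_ext)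

lemma mul_eq_iff: "mul z = mul w \<longleftrightarrow> z = w"
  by (metis k_closed(1) mult.right_neutral restrict_apply')

lemma mul_inv:
  assumes "z \<in> roots_of_unity d"
  shows "inv\<^bsub>GL k (*) k\<^esub> mul z = mul (inverse z)"
  unfolding m_inv_def
proof (rule the_equality)
  note z = root_of_unity[OF assms]
  show "mul (inverse z) \<in> carrier (GL k (*) k) \<and>
      mul z \<otimes>\<^bsub>GL k (*) k\<^esub> mul (inverse z) = \<one>\<^bsub>GL k (*) k\<^esub> \<and>
      mul (inverse z) \<otimes>\<^bsub>GL k (*) k\<^esub> mul z = \<one>\<^bsub>GL k (*) k\<^esub>"
    using z assms by (simp only: mul_mult mul_in_GL GL_simps(1)) simp
  fix g assume g: "g \<in> carrier (GL k (*) k) \<and> mul z \<otimes>\<^bsub>GL k (*) k\<^esub> g = \<one>\<^bsub>GL k (*) k\<^esub> \<and>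
      g \<otimes>\<^bsub>GL k (*) k\<^esub> mul z = \<one>\<^bsub>GL k (*) k\<^esub>"
  then have Bij: "g \<in> Bij k" by (simp add: GL_def)
  have comp: "compose k (mul z) g = mul 1"
    using g Bij mul_in_Bij[OF assms] by (simp add: GL_simps)
  show "g = mul (inverse z)"
  proof (rule extensionalityI[of _ k])
    fix x assume "x \<in> k"
    moreover then have "g x \<in> k" using Bij_imp_funcset[OF Bij] by blast
    ultimately have "z * g x = x" using fun_cong[OF comp, of x] by (simp add: compose_def)
    then show "g x = mul (inverse z) x" using \<open>x \<in> k\<close> z(2) by (simp add: field_simps)
  qed (use Bij_imp_extensional[OF Bij] in auto)
qed

text \<open>\<open>S\<close> need not contain the identity, since every generated subgroup does; the
  multiplications are closed under products and inverses.\<close>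

lemma generate_mul:
  assumes "S \<subseteq> mul ` roots_of_unity d" "mul ` (roots_of_unity d - {1}) \<subseteq> S"
  shows "generate (GL k (*) k) S = mul ` roots_of_unity d"
proof
  show "generate (GL k (*) k) S \<subseteq> mul ` roots_of_unity d"
  proof
    fix g assume "g \<in> generate (GL k (*) k) S"
    then show "g \<in> mul ` roots_of_unity d"
    proof induction
      case one
      show ?case using roots_of_unity_closed(1) by (simp only: GL_simps) (rule imageI)
    next
      case (incl h)
      then show ?case using assms(1) by blast
    next
      case (inv h)
      then obtain z where "z \<in> roots_of_unity d" "h = mul z" using assms(1) by blast
      then show ?case using mul_inv root_of_unity(4) by (metis imageI)
    next
      case (eng h1 h2)
      then obtain z w where "z \<in> roots_of_unity d" "h1 = mul z" "w \<in> roots_of_unity d" "h2 = mul w"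
        by blast
      then show ?case using mul_mult roots_of_unity_closed(2) by (metis imageI)
    qed
  qed
  show "mul ` roots_of_unity d \<subseteq> generate (GL k (*) k) S"
  proof
    fix g assume "g \<in> mul ` roots_of_unity d"
    then obtain z where z: "z \<in> roots_of_unity d" "g = mul z" by blast
    show "g \<in> generate (GL k (*) k) S"
    proof (cases "z = 1")
      case True
      then show ?thesis using generate.one[of "GL k (*) k" S] unfolding z(2) GL_simps(1) by (simp only:)
    next
      case False
      then show ?thesis using z assms(2) by (intro generate.incl) blast
    qed
  qed
qed

lemma mul_pow:
  assumes "z \<in> roots_of_unity d"
  shows "mul z [^]\<^bsub>GL k (*) k\<^esub> (n::nat) = mul (z ^ n)"
proof (induction n)
  case 0
  show ?case by (simp only: nat_pow_def rec_nat_0_imp GL_simps power_0 old.nat.rec)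
next
  case (Suc n)
  have "z ^ n \<in> roots_of_unity d" using roots_of_unity_closed assms by (induction n) auto
  then have "mul (z ^ n) \<otimes>\<^bsub>GL k (*) k\<^esub> mul z = mul (z ^ Suc n)"
    using mul_mult assms by (simp only: power_Suc2)
  then show ?case using Suc unfolding nat_pow_def by (simp only: old.nat.rec)
qed

text \<open>The only hyperplane of a line is \<open>{0}\<close>. Multiplication by
  \<open>z \<noteq> 1\<close> fixes nothing else, and its \<open>d\<close>-th power is the
  identity.\<close>

lemma reflection_mul_iff:
  assumes z: "z \<in> roots_of_unity d"
  shows "reflection k (*) k (mul z) \<longleftrightarrow> z \<noteq> 1"
proof
  assume "reflection k (*) k (mul z)"
  then have "hyperplane k (*) k {v \<in> k. mul z v = v}" unfolding reflection_def by blast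
  then obtain v where "v \<in> k - {v \<in> k. mul z v = v}" unfolding hyperplane_def by blast
  then show "z \<noteq> 1" by auto
next
  assume "z \<noteq> 1"
  then have fix0: "{v \<in> k. mul z v = v} = {0}" by (auto simp: k_closed)
  have "mprod k {0} = {0}"
    using mprod_least[of k "{0}" "{0}"] zero_in_mprod[of k 0 "{0}"] by (auto simp: k_closed)
  then have "lincomb k (*) {0} = {0}"
    using lincomb_eq_mprod[of k "{0}"] k_closed by simp
  moreover have "lincomb k (*) {1, 0} = k" by (rule lincomb_k[of _ 1]) (auto simp: k_closed)
  ultimately have "hyperplane k (*) k {0}"
    unfolding hyperplane_def using k_closed by (auto intro!: bexI[of _ 1])
  moreover have "mul z [^]\<^bsub>GL k (*) k\<^esub> d = \<one>\<^bsub>GL k (*) k\<^esub>"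
    using z by (simp only: mul_pow GL_simps roots_of_unity_def mem_Collect_eq)
  ultimately show "reflection k (*) k (mul z)"
    unfolding reflection_def fix0 using mul_in_GL[OF z] d by (auto intro!: exI[of _ d])
qed

text \<open>Since \<open>z * cnj z = 1\<close>, multiplication by \<open>z\<close> preserves the
  pairing and is therefore its own dual.\<close>

lemma dual_map_mul:
  assumes z: "z \<in> roots_of_unity d"
  shows "dual_map H (mul z) = mul z"
  unfolding dual_map_def
proof (rule the_equality)
  have "z * v * cnj (z * w) = v * cnj w" for v w
    using root_of_unity(2,5)[OF z] by simp
  then show "mul z \<in> carrier (GLW H) \<and>
      (\<forall>v\<in>spaceV H. \<forall>w\<in>spaceW H. pairing H (mul z v) (mul z w) = pairing H v w)"
    using mul_in_GL[OF z] by simp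
  fix h assume h: "h \<in> carrier (GLW H) \<and>
      (\<forall>v\<in>spaceV H. \<forall>w\<in>spaceW H. pairing H (mul z v) (h w) = pairing H v w)"
  then have Bij: "h \<in> Bij k" by (simp add: GL_def)
  show "h = mul z"
  proof (rule extensionalityI[of _ k])
    fix w assume w: "w \<in> k"
    \<comment> \<open>Evaluating the pairing identity at \<open>v = 1\<close> already determines
      \<open>h\<close>.\<close>
    then have "z * cnj (h w) = cnj w" using h k_closed(1) by force
    then have "cnj (z * cnj (h w)) = w" by simp
    then have "inverse z * h w = w" using root_of_unity(5)[OF z] by simp
    then show "h w = mul z w" using w root_of_unity(2)[OF z] by (simp add: field_simps)
  qed (use Bij_imp_extensional[OF Bij] in auto)
qed

text \<open>Both modules of a root are stable under multiplication by \<open>z\<close>. Invariance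
  of a root system under reflections in \<open>mu_action k d\<close> is thus automatic.\<close>

lemma act_mul:
  assumes "z \<in> roots_of_unity d" "is_root H r"
  shows "act H (mul z) r = r"
proof -
  obtain I J \<xi> where "r = (I, J, \<xi>)" by (metis prod_cases3)
  then show ?thesis
    using assms mul_image invertible_module by (auto simp: act_def dual_map_mul is_root_iff)
qed

lemma mu_action_eq: "mu_action k d = mul ` roots_of_unity d"
  by (simp add: mu_action_def)

lemma root_ne_1: "is_root H r \<Longrightarrow> snd (snd r) \<noteq> 1"
  by (cases r) (simp add: is_root_iff)

lemma root_reflection_eq': "is_root H r \<Longrightarrow> root_reflection H r = mul (snd (snd r))"
  by (cases r) (simp add: root_reflection_eq)

section \<open>Root systems and ideal families\<close>

text \<open>The root with index \<open>j\<close> reflects by \<open>zeta d ^ j\<close>. As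
  \<open>j\<close> varies, each nontrivial element of the group occurs exactly once, which gives
  generation, completeness and reducedness together; integrality of the cross products is the only
  condition linking different indices.\<close>

lemma complete_reduced_root_systemI:
  assumes root: "\<And>j. j \<in> {1..d - 1} \<Longrightarrow> is_root H (I j, J j, zeta d ^ j)"
    and int: "\<And>i j. i \<in> {1..d - 1} \<Longrightarrow> j \<in> {1..d - 1} \<Longrightarrow> mprod (I i) (cnj ` J j) \<subseteq> Zk"
  shows "{(I j, J j, zeta d ^ j) |j. j \<in> {1..d - 1}} \<in> complete_reduced_root_systems H (mu_action k d)"
proof -
  define R where "R = (\<lambda>j. (I j, J j, zeta d ^ j)) ` {1..d - 1}"
  have roots: "\<forall>r\<in>R. is_root H r" using root by (auto simp: R_def)
  have refl: "root_reflection H ` R = mul ` (roots_of_unity d - {1})"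
    unfolding R_def roots_of_unity_minus_1 image_image
    by (intro image_cong refl root_reflection_eq root)
  have modules: "Zk_module (I j)" "Zk_module (J j)" if "j \<in> {1..d - 1}" for j
    using root[OF that] invertible_module by (auto simp: is_root_iff)
  have "1 \<in> {1..d - 1}" using d by simp
  then obtain x where x: "x \<in> I 1" "x \<noteq> 0"
    using root[of 1] invertible_ne by (auto simp: is_root_iff)
  have "lincomb k (*) (\<Union>r\<in>R. fst r) = k"
  proof (rule lincomb_k)
    show "(\<Union>r\<in>R. fst r) \<subseteq> k" using Zk_moduleD(1)[OF modules(1)] by (auto simp: R_def)
    show "x \<in> (\<Union>r\<in>R. fst r)" using x(1) \<open>1 \<in> {1..d - 1}\<close> unfolding R_def by force
  qed (rule x)
  moreover have "act H (root_reflection H r) ` R = R" if "r \<in> R" for r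
  proof -
    have "root_reflection H r \<in> mul ` (roots_of_unity d - {1})"
      unfolding refl[symmetric] using that by (rule imageI)
    then obtain z where "z \<in> roots_of_unity d" "root_reflection H r = mul z" by blast
    then have "act H (root_reflection H r) r' = r'" if "r' \<in> R" for r'
      using act_mul roots that by simp
    then have "act H (root_reflection H r) ` R = (\<lambda>r. r) ` R" by (intro image_cong) auto
    then show ?thesis by simp
  qed
  moreover have "pairing_ideal H (fst r1) (fst (snd r2)) \<subseteq> Zk" if r: "r1 \<in> R" "r2 \<in> R" for r1 r2
  proof -
    obtain i j where "i \<in> {1..d - 1}" "fst r1 = I i" "j \<in> {1..d - 1}" "fst (snd r2) = J j"
      using r unfolding R_def by auto
    then show ?thesis using int[of i j] by (simp only: pairing_ideal_eq modules)
  qed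
  moreover have "finite R" unfolding R_def by simp
  ultimately have "root_system H R"
    unfolding root_system_def using roots by simp
  moreover have "generate (GLV H) (root_reflection H ` R) = mu_action k d"
    unfolding refl mu_action_eq standard_pair_simps by (rule generate_mul) auto
  moreover have "is_reduced H R"
    unfolding is_reduced_def
    by (auto intro!: inj_onI simp: R_def root_reflection_eq root mul_eq_iff zeta_inj)
  moreover have "is_complete H (mu_action k d) R"
    unfolding is_complete_def refl mu_action_eq using reflection_mul_iff by auto
  ultimately have "R \<in> complete_reduced_root_systems H (mu_action k d)"
    by (simp add: complete_reduced_root_systems_def root_system_for_def)
  then show ?thesis by (simp only: R_def Setcompr_eq_image)
qed

text \<open>Generation forces the third component of every root into the \<open>d\<close>-th roots
  of unity, completeness provides a root for each nontrivial one, and reducedness makes that root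
  unique. So the system can be indexed by exponents.\<close>

lemma complete_reduced_root_systemE:
  assumes "R \<in> complete_reduced_root_systems H (mu_action k d)"
  obtains I J where "R = {(I j, J j, zeta d ^ j) |j. j \<in> {1..d - 1}}"
    "\<And>j. j \<in> {1..d - 1} \<Longrightarrow> is_root H (I j, J j, zeta d ^ j)"
    "\<And>i j. i \<in> {1..d - 1} \<Longrightarrow> j \<in> {1..d - 1} \<Longrightarrow> mprod (I i) (cnj ` J j) \<subseteq> Zk"
proof -
  have sys: "root_system H R" and gen: "generate (GLV H) (root_reflection H ` R) = mu_action k d"
    and red: "inj_on (root_reflection H) R" and comp: "is_complete H (mu_action k d) R"
    using assms by (auto simp: complete_reduced_root_systems_def root_system_for_def is_reduced_def)
  have roots: "is_root H r" if "r \<in> R" for r using sys that by (simp add: root_system_def)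
  have snd: "snd (snd r) \<in> roots_of_unity d - {1}" if "r \<in> R" for r
  proof -
    have "root_reflection H r \<in> mu_action k d"
      unfolding gen[symmetric] using that by (intro generate.incl imageI)
    then show ?thesis
      using roots[OF that] root_ne_1 by (auto simp: root_reflection_eq' mu_action_eq mul_eq_iff)
  qed
  have uniq: "r = r'" if "r \<in> R" "r' \<in> R" "snd (snd r) = snd (snd r')" for r r'
    using inj_onD[OF red _ that(1,2)] roots that by (simp add: root_reflection_eq')
  have "\<exists>I J. (I, J, zeta d ^ j) \<in> R" if j: "j \<in> {1..d - 1}" for j
  proof -
    have "mul (zeta d ^ j) \<in> mu_action k d" "reflection k (*) k (mul (zeta d ^ j))"
      using zeta_root zeta_ne_1[OF j] by (auto simp: mu_action_eq reflection_mul_iff)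
    then have "mul (zeta d ^ j) \<in> root_reflection H ` R"
      using comp by (simp add: is_complete_def)
    then obtain r where "r \<in> R" "mul (zeta d ^ j) = root_reflection H r" by blast
    then have "r \<in> R" "snd (snd r) = zeta d ^ j"
      using roots by (simp_all add: root_reflection_eq' mul_eq_iff)
    then show ?thesis by (metis prod.collapse)
  qed
  then obtain I J where IJ: "(I j, J j, zeta d ^ j) \<in> R" if "j \<in> {1..d - 1}" for j
    by metis
  show thesis
  proof
    show "R = {(I j, J j, zeta d ^ j) |j. j \<in> {1..d - 1}}"
    proof
      show "R \<subseteq> {(I j, J j, zeta d ^ j) |j. j \<in> {1..d - 1}}"
      proof
        fix r assume r: "r \<in> R"
        from snd[OF r] have "snd (snd r) \<in> (\<lambda>j. zeta d ^ j) ` {1..d - 1}"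
          unfolding roots_of_unity_minus_1 .
        then obtain j where j: "j \<in> {1..d - 1}" "snd (snd r) = zeta d ^ j" by (rule imageE)
        then have "r = (I j, J j, zeta d ^ j)" using uniq[OF r IJ[OF j(1)]] by simp
        then show "r \<in> {(I j, J j, zeta d ^ j) |j. j \<in> {1..d - 1}}" using j(1) by blast
      qed
    qed (use IJ in auto)
    show root: "is_root H (I j, J j, zeta d ^ j)" if "j \<in> {1..d - 1}" for j
      using roots IJ[OF that] .
    fix i j assume ij: "i \<in> {1..d - 1}" "j \<in> {1..d - 1}"
    then have "pairing_ideal H (I i) (J j) \<subseteq> Zk"
      using sys IJ[OF ij(1)] IJ[OF ij(2)] unfolding root_system_def by fastforce
    then show "mprod (I i) (cnj ` J j) \<subseteq> Zk"
      using root[OF ij(1)] root[OF ij(2)] invertible_module by (simp add: is_root_iff pairing_ideal_eq)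
  qed
qed

section \<open>Divisors of \<open>1 - zeta d ^ j\<close> and the root systems they define\<close>

lemma one_minus_zeta:
  assumes "j \<in> {1..d - 1}"
  shows "1 - zeta d ^ j \<in> k" "1 - zeta d ^ j \<noteq> 0"
  using zeta_ne_1[OF assms] root_of_unity(1)[OF zeta_root] k_closed by auto

text \<open>Dividing the equation by \<open>c\<close> exhibits \<open>inverse c *o C\<close> as the
  inverse of \<open>M\<close>. Hence a cofactor is determined by the divisor.\<close>

lemma complement_of_divisor:
  assumes M: "Zk_module M" "Zk_module C" and c: "c \<in> k" "c \<noteq> 0" and MC: "mprod M C = c *o Zk"
  shows "invertible M" "c *o frac_inverse k M = C"
proof -
  have N: "Zk_module (inverse c *o C)" using M(2) c inverse_in_k by (intro Zk_module_elt_times)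
  have MN: "mprod M (inverse c *o C) = Zk"
    using MC c by (simp add: mprod_elt_times_right elt_times_inverse')
  show "invertible M" using M N MN by (auto simp: invertible_def)
  have "frac_inverse k M = inverse c *o C" by (rule frac_inverse_eqI[OF M(1) N MN])
  then show "c *o frac_inverse k M = C" using c by (simp add: elt_times_inverse)
qed

text \<open>The third fact is the divisibility in usable form: the complementary divisor is
  integral.\<close>

lemma ideal_familiesD:
  assumes "\<FF> \<in> ideal_families k d" "j \<in> {1..d - 1}"
  shows "invertible (\<FF> j)" "\<FF> j \<subseteq> Zk"
    "(1 - zeta d ^ j) *o frac_inverse k (\<FF> j) \<subseteq> Zk"
proof -
  have "ideal (\<FF> j) (integer_ring k)" "ideal_divides k (\<FF> j) ((1 - zeta d ^ j) *o Zk)"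
    using assms by (auto simp: ideal_families_def)
  then obtain C where C: "Zk_module (\<FF> j)" "\<FF> j \<subseteq> Zk" "Zk_module C" "C \<subseteq> Zk"
    "mprod (\<FF> j) C = (1 - zeta d ^ j) *o Zk"
    unfolding ideal_divides_def ideal_integer_ring_iff ideal_prod_eq_mprod by metis
  show "\<FF> j \<subseteq> Zk" by (fact C)
  show "invertible (\<FF> j)" "(1 - zeta d ^ j) *o frac_inverse k (\<FF> j) \<subseteq> Zk"
    using complement_of_divisor[OF C(1,3) one_minus_zeta[OF assms(2)] C(5)] C(4) by auto
qed

lemma family_root_system_complete:
  assumes "\<FF> \<in> ideal_families k d"
  shows "family_root_system k d \<FF> \<in> complete_reduced_root_systems H (mu_action k d)"
proof -
  \<comment> \<open>\<open>D j\<close> is the complementary divisor of \<open>\<FF> j\<close>, and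
    its conjugate is the second component of the root. Cross products are integral because
    \<open>\<FF> i\<close> and \<open>D j\<close> both lie in \<open>Zk\<close>.\<close>
  define D where "D j = (1 - zeta d ^ j) *o frac_inverse k (\<FF> j)" for j
  have J: "cnj (1 - zeta d ^ j) *o frac_inverse_conj k (\<FF> j) = cnj ` D j" for j
    by (simp only: D_def frac_inverse_conj_def cnj_elt_times)
  note F = ideal_familiesD[OF assms]
  have D: "invertible (D j)" "mprod (\<FF> j) (D j) = (1 - zeta d ^ j) *o Zk"
    if "j \<in> {1..d - 1}" for j
    using F(1)[OF that] one_minus_zeta[OF that]
    by (auto simp: D_def mprod_elt_times_right invertible_inverse
        intro: invertible_elt_times invertible_frac_inverse)
  show ?thesis
    unfolding family_root_system_def J
  proof (rule complete_reduced_root_systemI)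
    fix j assume j: "j \<in> {1..d - 1}"
    have "\<exists>n::nat. n > 0 \<and> (zeta d ^ j) ^ n = 1"
      using zeta_root[of j] d by (intro exI[of _ d]) (auto simp: roots_of_unity_def)
    then show "is_root H (\<FF> j, cnj ` D j, zeta d ^ j)"
      unfolding is_root_iff
      using F(1)[OF j] D[OF j] zeta_ne_1[OF j] root_of_unity(1)[OF zeta_root, of j]
      by (simp only: invertible_cnj_iff cnj_image_cnj) simp
  next
    fix i j assume ij: "i \<in> {1..d - 1}" "j \<in> {1..d - 1}"
    have "mprod (\<FF> i) (D j) \<subseteq> mprod Zk Zk"
      using F(2)[OF ij(1)] F(3)[OF ij(2)] by (intro mprod_mono) (auto simp: D_def)
    then show "mprod (\<FF> i) (cnj ` cnj ` D j) \<subseteq> Zk" using Zk_module_Zk by simp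
  qed
qed

text \<open>With the second component written as the conjugate of \<open>D\<close>, acting by the
  conjugate inverse of \<open>A\<close> amounts to multiplying \<open>D\<close> by the inverse of
  \<open>A\<close>.\<close>

lemma ideal_act_eq:
  assumes "invertible A" "invertible I" "invertible D"
  shows "ideal_act H A (I, cnj ` D, \<xi>) = (mprod A I, cnj ` mprod (frac_inverse k A) D, \<xi>)"
proof -
  have ne: "I \<noteq> {}" "cnj ` D \<noteq> {}"
    using invertible_ne[OF assms(2)] invertible_ne[OF assms(3)] by auto
  have A: "Zk_module A" "Zk_module (cnj ` frac_inverse k A)"
    using assms(1) invertible_module invertible_inverse(1) Zk_module_cnj by auto
  show ?thesis
    by (simp add: ideal_act_def frac_inverse_conj_def cnj_mprod lincomb_module[OF A(1) ne(1)]
        lincomb_module[OF A(2) ne(2)])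
qed

lemma ideal_act_family:
  assumes A: "invertible A" and \<FF>: "\<FF> \<in> ideal_families k d"
  shows "ideal_act H A ` family_root_system k d \<FF> =
    {(mprod A (\<FF> j), cnj ` mprod (frac_inverse k A) ((1 - zeta d ^ j) *o frac_inverse k (\<FF> j)),
      zeta d ^ j) |j. j \<in> {1..d - 1}}"
proof -
  have "ideal_act H A (\<FF> j, cnj (1 - zeta d ^ j) *o frac_inverse_conj k (\<FF> j), zeta d ^ j) =
    (mprod A (\<FF> j), cnj ` mprod (frac_inverse k A) ((1 - zeta d ^ j) *o frac_inverse k (\<FF> j)),
      zeta d ^ j)" if j: "j \<in> {1..d - 1}" for j
  proof -
    have "invertible (\<FF> j)" by (rule ideal_familiesD(1)[OF \<FF> j])
    moreover then have "invertible ((1 - zeta d ^ j) *o frac_inverse k (\<FF> j))"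
      using one_minus_zeta[OF j] by (intro invertible_elt_times invertible_frac_inverse)
    ultimately show ?thesis
      using ideal_act_eq[OF A] by (simp only: frac_inverse_conj_def cnj_elt_times[symmetric])
  qed
  then show ?thesis
    unfolding family_root_system_def Setcompr_eq_image image_image by (intro image_cong) auto
qed

text \<open>Scaling by the inverse of the sum of all first components makes these sum to
  \<open>Zk\<close>. The integrality conditions of the root system are exactly what makes the scaled
  modules divisors.\<close>

lemma same_genus_family_exists:
  assumes "R \<in> complete_reduced_root_systems H (mu_action k d)"
  shows "\<exists>\<FF>. \<FF> \<in> coprime_ideal_families k d \<and> same_genus H (family_root_system k d \<FF>) R"
proof -
  obtain I J where R: "R = {(I j, J j, zeta d ^ j) |j. j \<in> {1..d - 1}}"
    and root: "\<And>j. j \<in> {1..d - 1} \<Longrightarrow> is_root H (I j, J j, zeta d ^ j)"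
    and int: "\<And>i j. i \<in> {1..d - 1} \<Longrightarrow> j \<in> {1..d - 1} \<Longrightarrow> mprod (I i) (cnj ` J j) \<subseteq> Zk"
    using complete_reduced_root_systemE[OF assms] by blast
  define D where "D j = cnj ` J j" for j
  have I: "invertible (I j)" and D: "invertible (D j)"
    and ID: "mprod (I j) (D j) = (1 - zeta d ^ j) *o Zk" if "j \<in> {1..d - 1}" for j
    using root[OF that] by (auto simp: is_root_iff D_def invertible_cnj_iff)
  have "1 \<in> {1..d - 1}" using d by simp
  define B where "B = (\<Sum>j\<in>{1..d - 1}. I j)"
  have B: "invertible B" unfolding B_def
    by (rule invertible_sum) (use I \<open>1 \<in> {1..d - 1}\<close> in auto)
  define B' where "B' = frac_inverse k B"
  have B': "Zk_module B'" "mprod B B' = Zk" "mprod B' B = Zk"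
    using invertible_inverse[OF B] mprod_commute by (auto simp: B'_def)
  have mod: "Zk_module B" "\<And>j. j \<in> {1..d - 1} \<Longrightarrow> Zk_module (I j)"
    "\<And>j. j \<in> {1..d - 1} \<Longrightarrow> Zk_module (D j)"
    using B I D invertible_module by auto
  define \<FF> where "\<FF> = (\<lambda>j\<in>{1..d - 1}. mprod B' (I j))"
  have \<FF>_sub: "mprod B' (I j) \<subseteq> Zk" if "j \<in> {1..d - 1}" for j
  proof -
    have "I j \<subseteq> B" unfolding B_def using that mod(2) by (intro Zk_module_le_sum) auto
    then have "mprod B' (I j) \<subseteq> mprod B' B" by (intro mprod_mono) auto
    then show ?thesis using B' by simp
  qed
  \<comment> \<open>Here all the conditions between different roots are used: \<open>B\<close> is
    the sum of the \<open>I i\<close>, and every product of \<open>I i\<close> with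
    \<open>D j\<close> is integral.\<close>
  have BD_sub: "mprod B (D j) \<subseteq> Zk" if "j \<in> {1..d - 1}" for j
  proof -
    have "mprod B (D j) = (\<Sum>i\<in>{1..d - 1}. mprod (D j) (I i))"
      unfolding B_def mprod_commute[of _ "D j"] using that mod by (intro mprod_sum_right) auto
    also have "\<dots> \<subseteq> Zk"
      using int[OF _ that] by (intro Zk_module_sum_least Zk_module_Zk) (auto simp: D_def mprod_commute)
    finally show ?thesis .
  qed
  \<comment> \<open>\<open>B'\<close> cancels \<open>B\<close>, so the ideal
    \<open>mprod B (D j)\<close> is the complementary divisor of
    \<open>mprod B' (I j)\<close>.\<close>
  have FD: "mprod (mprod B' (I j)) (mprod B (D j)) = (1 - zeta d ^ j) *o Zk"
    if "j \<in> {1..d - 1}" for j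
  proof -
    have "mprod (mprod B' (I j)) (mprod B (D j)) = mprod (mprod B' B) (mprod (I j) (D j))"
      by (simp only: mprod_assoc mprod_left_commute[of "I j"])
    then show ?thesis
      using ID[OF that] B'(3) Zk_module_Zk one_minus_zeta(1)[OF that] by (simp add: Zk_module_elt_times)
  qed
  have fam: "\<FF> \<in> ideal_families k d"
    unfolding ideal_families_def
  proof (rule PiE_I)
    fix j assume j: "j \<in> {1..d - 1}"
    have "ideal (mprod B' (I j)) (integer_ring k)"
      using B' mod(2)[OF j] \<FF>_sub[OF j] by (simp add: ideal_integer_ring_iff Zk_module_mprod)
    moreover have "ideal (mprod B (D j)) (integer_ring k)"
      using mod(1) mod(3)[OF j] BD_sub[OF j] by (simp add: ideal_integer_ring_iff Zk_module_mprod)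
    then have "ideal_divides k (mprod B' (I j)) ((1 - zeta d ^ j) *o Zk)"
      unfolding ideal_divides_def ideal_prod_eq_mprod using FD[OF j] by metis
    ultimately show "\<FF> j \<in> {\<aa>. ideal \<aa> (integer_ring k) \<and> ideal_divides k \<aa> ((1 - zeta d ^ j) *o Zk)}"
      using j by (simp add: \<FF>_def)
  qed (auto simp: \<FF>_def)
  have "(\<Sum>j\<in>{1..d - 1}. \<FF> j) = (\<Sum>j\<in>{1..d - 1}. mprod B' (I j))"
    by (intro sum.cong) (auto simp: \<FF>_def)
  also have "\<dots> = Zk" using mprod_sum_right[OF B'(1), of "{1..d - 1}" I] mod(2) B'(3) by (simp add: B_def)
  finally have "\<FF> \<in> coprime_ideal_families k d" using fam by (simp add: coprime_ideal_families_def)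
  moreover have "same_genus H (family_root_system k d \<FF>) R"
  proof -
    have "mprod B (\<FF> j) = I j \<and>
        cnj ` mprod (frac_inverse k B) ((1 - zeta d ^ j) *o frac_inverse k (\<FF> j)) = J j"
      if j: "j \<in> {1..d - 1}" for j
    proof
      show "mprod B (\<FF> j) = I j"
        using j B' mod(2)[OF j] by (simp add: \<FF>_def mprod_assoc[symmetric])
      \<comment> \<open>Uniqueness of the cofactor identifies the second component; multiplying by
        \<open>B'\<close> then recovers \<open>D j\<close>.\<close>
      have "(1 - zeta d ^ j) *o frac_inverse k (\<FF> j) = mprod B (D j)"
        using complement_of_divisor(2)[OF _ _ one_minus_zeta[OF j] FD[OF j]] j B' mod(1) mod(2,3)[OF j]
        by (simp add: \<FF>_def Zk_module_mprod)
      then have "mprod B' ((1 - zeta d ^ j) *o frac_inverse k (\<FF> j)) = D j"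
        using B' mod(3)[OF j] by (simp add: mprod_assoc[symmetric])
      then show "cnj ` mprod (frac_inverse k B) ((1 - zeta d ^ j) *o frac_inverse k (\<FF> j)) = J j"
        by (simp only: B'_def[symmetric]) (simp add: D_def)
    qed
    then have "ideal_act H B ` family_root_system k d \<FF> = R"
      unfolding ideal_act_family[OF B fam] R Setcompr_eq_image by (intro image_cong) auto
    then show ?thesis
      using B unfolding same_genus_def standard_pair_simps fractional_ideal_iff_invertible by blast
  qed
  ultimately show ?thesis by blast
qed

text \<open>Since each coprime family sums to \<open>Zk\<close>, the sum of the first components of
  \<open>R\<close> is at once \<open>A\<close> and \<open>B\<close>. Cancelling this common
  invertible factor identifies the families.\<close>

lemma same_genus_family_unique:
  assumes \<FF>: "\<FF> \<in> coprime_ideal_families k d" "same_genus H (family_root_system k d \<FF>) R"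
    and \<GG>: "\<GG> \<in> coprime_ideal_families k d" "same_genus H (family_root_system k d \<GG>) R"
  shows "\<FF> = \<GG>"
proof -
  have fam: "\<FF> \<in> ideal_families k d" "\<GG> \<in> ideal_families k d"
    and sums: "(\<Sum>j\<in>{1..d - 1}. \<FF> j) = Zk" "(\<Sum>j\<in>{1..d - 1}. \<GG> j) = Zk"
    using \<FF>(1) \<GG>(1) by (auto simp: coprime_ideal_families_def)
  obtain A where A: "invertible A" "R = ideal_act H A ` family_root_system k d \<FF>"
    using \<FF>(2) by (auto simp: same_genus_def fractional_ideal_iff_invertible)
  obtain B where B: "invertible B" "R = ideal_act H B ` family_root_system k d \<GG>"
    using \<GG>(2) by (auto simp: same_genus_def fractional_ideal_iff_invertible)
  \<comment> \<open>The powers \<open>zeta d ^ j\<close> are distinct for these exponents, so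
    equality of the two sets of roots can be compared index by index.\<close>
  have eq: "mprod A (\<FF> j) = mprod B (\<GG> j)" if j: "j \<in> {1..d - 1}" for j
  proof -
    have "\<exists>J. (mprod A (\<FF> j), J, zeta d ^ j) \<in> R"
      unfolding A(2) ideal_act_family[OF A(1) fam(1)] using j by blast
    then obtain i where "i \<in> {1..d - 1}" "mprod A (\<FF> j) = mprod B (\<GG> i)" "zeta d ^ j = zeta d ^ i"
      unfolding B(2) ideal_act_family[OF B(1) fam(2)] by blast
    then show ?thesis using zeta_inj[OF j] by simp
  qed
  have mod: "Zk_module (\<FF> j)" "Zk_module (\<GG> j)" if "j \<in> {1..d - 1}" for j
    using ideal_familiesD(1)[OF fam(1) that] ideal_familiesD(1)[OF fam(2) that] invertible_module by auto
  have "A = mprod A (\<Sum>j\<in>{1..d - 1}. \<FF> j)"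
    unfolding sums using A(1) invertible_module by simp
  also have "\<dots> = (\<Sum>j\<in>{1..d - 1}. mprod A (\<FF> j))"
    using mod(1) A(1) invertible_module by (intro mprod_sum_right) auto
  also have "\<dots> = (\<Sum>j\<in>{1..d - 1}. mprod B (\<GG> j))" using eq by (intro sum.cong) auto
  also have "\<dots> = mprod B (\<Sum>j\<in>{1..d - 1}. \<GG> j)"
    using mod(2) B(1) invertible_module by (intro mprod_sum_right[symmetric]) auto
  also have "\<dots> = B" unfolding sums using B(1) invertible_module by simp
  finally have "A = B" .
  show ?thesis
  \<comment> \<open>Families are extensional, so agreement at the indices from \<open>1\<close> to
    \<open>d - 1\<close> suffices.\<close>
  proof (rule PiE_ext)
    show "\<FF> \<in> PiE {1..d - 1} (\<lambda>j. {\<aa>. ideal \<aa> (integer_ring k) \<and> ideal_divides k \<aa> ((1 - zeta d ^ j) *o Zk)})"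
      "\<GG> \<in> PiE {1..d - 1} (\<lambda>j. {\<aa>. ideal \<aa> (integer_ring k) \<and> ideal_divides k \<aa> ((1 - zeta d ^ j) *o Zk)})"
      using fam by (simp_all add: ideal_families_def)
    show "\<FF> j = \<GG> j" if "j \<in> {1..d - 1}" for j
      using invertible_cancel[OF A(1) mod[OF that]] eq[OF that] \<open>A = B\<close> by simp
  qed
qed

end

theorem proposition4p1:
  fixes d :: nat and k :: "complex set"
  assumes "d \<ge> 2"
    and "number_field k"
    and "cnj ` k \<subseteq> k"
    and "roots_of_unity d \<subseteq> k"
  shows "(\<forall>\<FF> \<in> ideal_families k d.
            family_root_system k d \<FF>
              \<in> complete_reduced_root_systems (standard_pair k) (mu_action k d))
       \<and> (\<forall>\<FF> \<in> coprime_ideal_families k d.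
            family_root_system k d \<FF>
              \<in> complete_reduced_root_systems (standard_pair k) (mu_action k d))
       \<and> (\<forall>\<RR> \<in> complete_reduced_root_systems (standard_pair k) (mu_action k d).
            \<exists>!\<FF>. \<FF> \<in> coprime_ideal_families k d \<and>
                  same_genus (standard_pair k) (family_root_system k d \<FF>) \<RR>)"
proof -
  interpret cyclotomic_number_field k d
    using assms by unfold_locales
  \<comment> \<open>The second claim is thus a case of the first.\<close>
  have "coprime_ideal_families k d \<subseteq> ideal_families k d"
    by (auto simp: coprime_ideal_families_def)
  then show ?thesis
    using family_root_system_complete same_genus_family_exists same_genus_family_unique
    by (intro conjI ballI ex_ex1I) blast+
qed

end
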